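(* Let $r\ge2$, $1\le c\le r-1$, $l\ge2$, and $\mathcal{U}=\{S^{(r)}(1,c),S^{(r)}(2,c),\ldots,S^{(r)}(l,c)\}$. Then $$\operatorname{trop}(\mathcal{G}_\mathcal{U})=\{\mathbf y\in\mathbb{R}^l:\ \mathbf a_b^\top\mathbf y\ge0\ \text{ for all }1\le b\le l\},$$ where $\mathbf a_1^\top\mathbf y=-2y_{S^{(r)}(1,c)}+y_{S^{(r)}(2,c)}$, $\mathbf a_b^\top\mathbf y=y_{S^{(r)}(b-1,c)}-2y_{S^{(r)}(b,c)}+y_{S^{(r)}(b+1,c)}$ for $2\le b\le l-1$, and $\mathbf a_l^\top\mathbf y=y_{S^{(r)}(l-1,c)}-y_{S^{(r)}(l,c)}$. Moreover, the extreme rays of $\operatorname{trop}(\mathcal{G}_\mathcal{U})$ are $\mathbf u_1,\ldots,\mathbf u_l$, where $$\mathbf u_b=-\sum_{j=1}^{b}j\,\mathbf 1_{S^{(r)}(j,c)}-\sum_{j=b+1}^{l}b\,\mathbf 1_{S^{(r)}(j,c)}.$$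
   Context: $S^{(r)}(b,c)$ denotes the $r$-uniform hypergraph with $b$ edges, all of which intersect in a common set of $c$ vertices and nowhere else (so it has $b(r-c)+c$ vertices). Homomorphism densities of $r$-uniform hypergraphs: $t(H;G)$ is the number of maps $\varphi:V(H)\to V(G)$ with $\{\varphi(u_1),\dots,\varphi(u_r)\}\in E(G)$ for every edge $\{u_1,\dots,u_r\}$ of $H$, divided by $|V(G)|^{|V(H)|}$. $\mathcal{G}_\mathcal{U}\subseteq\mathbb{R}^l$ is the closure of the set of vectors $(t(S^{(r)}(1,c);G),\ldots,t(S^{(r)}(l,c);G))$ over all $r$-uniform hypergraphs $G$; $y_{S^{(r)}(b,c)}$ is the coordinate indexed by $S^{(r)}(b,c)$ and $\mathbf 1_{S^{(r)}(b,c)}$ the corresponding standard basis vector. $\operatorname{trop}(\mathcal S)$ is the set of $\mathbf y$ such that there exist $\tau_k\in(0,1)$, $\tau_k\to0$, and $\mathbf y(k)\in\mathcal S\cap\mathbb{R}^l_{>0}$ with $\frac{-1}{\log_e\tau_k}(\log_e y(k)_1,\ldots,\log_e y(k)_l)\to\mathbf y$. *)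

theory Defs
  imports "HOL-Analysis.Analysis"
begin

record 'a hypergraph =
  verts :: "'a set"
  edges :: "'a set set"

definition uniform_hypergraph :: "nat \<Rightarrow> 'a hypergraph \<Rightarrow> bool" where
  "uniform_hypergraph r G \<longleftrightarrow>
     finite (verts G) \<and> (\<forall>e\<in>edges G. e \<subseteq> verts G \<and> card e = r)"

definition homs :: "'a hypergraph \<Rightarrow> 'b hypergraph \<Rightarrow> ('a \<Rightarrow> 'b) set" where
  "homs H G = {\<phi> \<in> verts H \<rightarrow>\<^sub>E verts G. \<forall>e\<in>edges H. \<phi> ` e \<in> edges G}"

definition hom_density :: "'a hypergraph \<Rightarrow> 'b hypergraph \<Rightarrow> real" where
  "hom_density H G = real (card (homs H G)) / real (card (verts G)) ^ card (verts H)"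

text \<open>The hypergraph $S^{(r)}(b,c)$: the common \<open>c\<close> vertices are \<open>(0, j)\<close> with \<open>j < c\<close>, and the
  vertices belonging only to the \<open>i\<close>-th edge (\<open>1 \<le> i \<le> b\<close>) are \<open>(i, j)\<close> with \<open>j < r - c\<close>.\<close>

definition star_edge :: "nat \<Rightarrow> nat \<Rightarrow> nat \<Rightarrow> (nat \<times> nat) set" where
  "star_edge r c i = {0} \<times> {..<c} \<union> {i} \<times> {..<r - c}"

definition star :: "nat \<Rightarrow> nat \<Rightarrow> nat \<Rightarrow> (nat \<times> nat) hypergraph" where
  "star r b c = \<lparr>verts = {0} \<times> {..<c} \<union> {1..b} \<times> {..<r - c}, edges = star_edge r c ` {1..b}\<rparr>"

lemma star_edge_card: "c \<le> r \<Longrightarrow> 1 \<le> i \<Longrightarrow> card (star_edge r c i) = r"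
  unfolding star_edge_def by (subst card_Un_disjoint) (auto simp: card_cartesian_product)

lemma star_uniform: "c \<le> r \<Longrightarrow> uniform_hypergraph r (star r b c)"
  by (auto simp: uniform_hypergraph_def star_def star_edge_card) (auto simp: star_edge_def)

lemma star_card_verts: "card (verts (star r b c)) = b * (r - c) + c"
  unfolding star_def by (simp, subst card_Un_disjoint) (auto simp: card_cartesian_product)

lemma star_card_edges:
  assumes "c < r"
  shows "card (edges (star r b c)) = b"
proof -
  have "inj_on (star_edge r c) {1..b}"
  proof (rule inj_onI)
    fix i j assume "i \<in> {1..b}" "j \<in> {1..b}" "star_edge r c i = star_edge r c j"
    moreover have "(i, 0) \<in> star_edge r c i"
      using assms by (simp add: star_edge_def)
    ultimately show "i = j" by (auto simp: star_edge_def)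
  qed
  then show ?thesis by (simp add: star_def card_image)
qed

lemma star_edge_Int: "1 \<le> i \<Longrightarrow> i \<noteq> j \<Longrightarrow> 1 \<le> j \<Longrightarrow>
    star_edge r c i \<inter> star_edge r c j = {0} \<times> {..<c}"
  by (auto simp: star_edge_def)

text \<open>The closure of the set of vectors $(t(U_1;G),\dots,t(U_l;G))$ over all \<open>r\<close>-uniform
  hypergraphs \<open>G\<close>.  The coordinates of \<open>real ^ 'l\<close> are enumerated by a bijection \<open>\<sigma>\<close> from
  \<open>{1..l}\<close>, so that \<open>v $ \<sigma> b\<close> is the coordinate indexed by \<open>U b\<close>.  Hypergraphs are finite, so up to
  isomorphism all of them occur with vertices in \<open>nat\<close>; the density in \<open>G\<close> is only meaningful if
  \<open>G\<close> has a vertex.\<close>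

definition density_profile ::
    "nat \<Rightarrow> nat \<Rightarrow> (nat \<Rightarrow> 'l) \<Rightarrow> (nat \<Rightarrow> 'a hypergraph) \<Rightarrow> (real ^ 'l::finite) set" where
  "density_profile r l \<sigma> U =
     closure {v. \<exists>G :: nat hypergraph. uniform_hypergraph r G \<and> verts G \<noteq> {} \<and>
                   (\<forall>b\<in>{1..l}. v $ \<sigma> b = hom_density (U b) G)}"

definition trop :: "(real ^ 'l::finite) set \<Rightarrow> (real ^ 'l) set" where
  "trop S = {y. \<exists>(\<tau> :: nat \<Rightarrow> real) (x :: nat \<Rightarrow> real ^ 'l).
     (\<forall>k. 0 < \<tau> k \<and> \<tau> k < 1) \<and> \<tau> \<longlonglongrightarrow> 0 \<and>
     (\<forall>k. x k \<in> S \<and> (\<forall>i. 0 < x k $ i)) \<and>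
     (\<lambda>k. (- 1 / ln (\<tau> k)) *\<^sub>R (\<chi> i. ln (x k $ i))) \<longlonglongrightarrow> y}"

text \<open>An extreme ray of a convex cone is a face that is a half-line from the origin.\<close>

definition extreme_ray_of :: "'a::real_vector set \<Rightarrow> 'a set \<Rightarrow> bool" (infixr "(extreme'_ray'_of)" 50)
  where "R extreme_ray_of C \<longleftrightarrow> R face_of C \<and> (\<exists>u. u \<noteq> 0 \<and> R = cone hull {u})"

definition star_ray :: "nat \<Rightarrow> (nat \<Rightarrow> 'l) \<Rightarrow> nat \<Rightarrow> real ^ 'l::finite" where
  "star_ray l \<sigma> b = - (\<Sum>j=1..b. real j *\<^sub>R axis (\<sigma> j) 1) - (\<Sum>j=b+1..l. real b *\<^sub>R axis (\<sigma> j) 1)"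

end

theory Submission
  imports Defs
begin

text \<open>
  The density of $S^{(r)}(b,c)$ in \<open>G\<close> is the \<open>b\<close>-th moment of a random variable with values in
  $[0,1]$, the normalised degree of a uniformly random \<open>c\<close>-tuple of vertices. By the Cauchy-Schwarz
  inequality moments are log-convex, and they are nonincreasing, so the tropicalization lies in the
  cone.

  Conversely, a point \<open>y\<close> of the cone is a convex nonincreasing sequence starting at $y_0 = 0$, hence
  the maximum of its tangent lines $L_k(b) = L_k(0) + b\,d_k$, where $L_k(0) \le 0$ and $d_k \le 0$. It
  therefore suffices to find, for large \<open>q\<close>, a hypergraph whose \<open>b\<close>-th moment is
  $\sum_k q^{L_k(0)} (q^{d_k})^b$ up to a constant factor. Such a hypergraph is a union of layers: the
  \<open>k\<close>-th one consists of the \<open>r\<close>-sets with at least \<open>c\<close> points in a set of density $q^{L_k(0)/c}$ whose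
  sum modulo \<open>n\<close> lies in a set of density $q^{d_k}$. The \<open>c\<close>-tuples only partly inside that set
  have smaller degree, and their contribution to the moments does not dominate.

  The defining functionals $\mathbf a_b$ of the cone are dual to the vectors $\mathbf u_b$, so the cone
  is simplicial with the $\mathbf u_b$ as its extreme rays.
\<close>

section \<open>Simplicial cones\<close>

lemma cone_hull_singleton: "cone hull {u} = {t *\<^sub>R u | t. 0 \<le> t}"
  by (auto simp: cone_hull_expl)

text \<open>The functionals \<open>a i\<close> separate points and are dual to the
  \<open>u i\<close>, so they serve as coordinates in which the cone is cut out by nonnegativity.
  The ray of \<open>u j\<close> is a face because all coordinates but the j-th vanish on it.
  Conversely, splitting off one coordinate of the generator of a ray that is a face cannot leave
  that ray.\<close>

lemma extreme_rays_simplicial_cone: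
  fixes a :: "'i \<Rightarrow> 'v::real_vector \<Rightarrow> real" and u :: "'i \<Rightarrow> 'v"
  assumes lin: "\<And>i. i \<in> I \<Longrightarrow> linear (a i)"
    and dual: "\<And>i j. i \<in> I \<Longrightarrow> j \<in> I \<Longrightarrow> a i (u j) = (if i = j then 1 else 0)"
    and inj: "\<And>y. (\<And>i. i \<in> I \<Longrightarrow> a i y = 0) \<Longrightarrow> y = 0"
  shows "{R. R extreme_ray_of {y. \<forall>i\<in>I. 0 \<le> a i y}} = (\<lambda>i. cone hull {u i}) ` I"
proof -
  define P where "P = {y. \<forall>i\<in>I. 0 \<le> a i y}"
  note lins = linear_add[OF lin] linear_cmul[OF lin] linear_diff[OF lin]
  have eqI: "x = y" if "\<And>i. i \<in> I \<Longrightarrow> a i x = a i y" for x y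
    using inj[of "x - y"] that by (simp add: lins)
  have uP: "t *\<^sub>R u j \<in> P" if "j \<in> I" "0 \<le> t" for j t
    using that by (auto simp: P_def lins dual)
  have "R extreme_ray_of P \<longleftrightarrow> R \<in> (\<lambda>i. cone hull {u i}) ` I" for R
  proof
    assume "R \<in> (\<lambda>i. cone hull {u i}) ` I"
    then obtain j where j: "j \<in> I" and R: "R = cone hull {u j}"
      by auto
    have "R face_of P"
      unfolding face_of_def
    proof (intro conjI ballI impI)
      show "R \<subseteq> P"
        using uP[OF j] by (auto simp: R cone_hull_singleton)
      show "convex R"
        unfolding R by (intro convex_cone_hull) simp
      fix x y z
      assume x: "x \<in> P" and y: "y \<in> P" and "z \<in> R" "z \<in> open_segment x y"
      then obtain s t where s: "0 < s" "s < 1" and z: "z = (1 - s) *\<^sub>R x + s *\<^sub>R y"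
        and t: "z = t *\<^sub>R u j"
        by (auto simp: in_segment R cone_hull_singleton)
      have zero: "a i x = 0 \<and> a i y = 0" if i: "i \<in> I" "i \<noteq> j" for i
      proof -
        have "(1 - s) * a i x + s * a i y = a i z"
          using i by (simp add: z lins)
        also have "\<dots> = 0"
          using i j by (simp add: t lins dual)
        finally have "(1 - s) * a i x + s * a i y = 0" .
        moreover have "0 \<le> (1 - s) * a i x" "0 \<le> s * a i y"
          using x y s i by (auto simp: P_def)
        ultimately have "(1 - s) * a i x = 0" "s * a i y = 0"
          by linarith+
        then show ?thesis
          using s by auto
      qed
      have "x = a j x *\<^sub>R u j" "y = a j y *\<^sub>R u j"
        using zero j by (auto intro!: eqI simp: lins dual)
      moreover have "0 \<le> a j x" "0 \<le> a j y"
        using x y j by (auto simp: P_def)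
      ultimately show "x \<in> R" "y \<in> R"
        unfolding R cone_hull_singleton by blast+
    qed
    moreover have "u j \<noteq> 0"
      using dual[OF j j] linear_0[OF lin[OF j]] by auto
    ultimately show "R extreme_ray_of P"
      unfolding extreme_ray_of_def R by blast
  next
    assume "R extreme_ray_of P"
    then obtain v where face: "R face_of P" and v: "v \<noteq> 0" and R: "R = cone hull {v}"
      unfolding extreme_ray_of_def by blast
    have "v \<in> R"
      unfolding R by (simp add: hull_inc)
    then have vP: "v \<in> P"
      using face_of_imp_subset[OF face] by blast
    obtain j where j: "j \<in> I" and "a j v \<noteq> 0"
      using inj v by blast
    define t where "t = a j v"
    have t: "0 < t"
      using vP j \<open>a j v \<noteq> 0\<close> by (force simp: P_def t_def)
    \<comment> \<open>Removing the j-th coordinate of \<open>v\<close> leaves a point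
      \<open>w\<close> of the cone, so \<open>v\<close> is the midpoint of 2 t u_j and 2 w; the face
      property then puts 2 t u_j on the ray.\<close>
    define w where "w = v - t *\<^sub>R u j"
    have wP: "2 *\<^sub>R w \<in> P"
      using vP j by (auto simp: P_def w_def lins dual t_def)
    have tP: "(2 * t) *\<^sub>R u j \<in> P"
      using uP j t by simp
    have mid: "v = (1 - 1/2) *\<^sub>R ((2 * t) *\<^sub>R u j) + (1/2) *\<^sub>R (2 *\<^sub>R w)"
      by (simp add: w_def)
    have "(2 * t) *\<^sub>R u j \<in> R"
    proof (cases "(2 * t) *\<^sub>R u j = 2 *\<^sub>R w")
      \<comment> \<open>Coinciding endpoints span an empty open segment, to which the face property
        does not apply.\<close>
      case True
      then have "v = (2 * t) *\<^sub>R u j"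
        using mid by (simp add: scaleR_left_distrib[symmetric] del: scaleR_scaleR)
      then show ?thesis
        using \<open>v \<in> R\<close> by simp
    next
      case False
      then have "v \<in> open_segment ((2 * t) *\<^sub>R u j) (2 *\<^sub>R w)"
        unfolding in_segment using mid
        by (intro conjI exI[of _ "1/2"]) auto
      then show ?thesis
        using face_ofD[OF face _ tP wP \<open>v \<in> R\<close>] by blast
    qed
    then obtain s where s: "0 \<le> s" "(2 * t) *\<^sub>R u j = s *\<^sub>R v"
      unfolding R cone_hull_singleton by auto
    have "a j ((2 * t) *\<^sub>R u j) = s * t"
      unfolding s by (simp add: lins j t_def)
    then have "s = 2"
      using j t by (simp add: lins dual)
    with s have "v = t *\<^sub>R u j"
      by (metis scaleR_left_imp_eq scaleR_scaleR zero_neq_numeral)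
    then have "R = cone hull {u j}"
      unfolding R cone_hull_singleton
    proof (intro subset_antisym subsetI; clarsimp)
      fix x :: real assume "0 \<le> x"
      then show "\<exists>y. (x * t = y \<or> u j = 0) \<and> 0 \<le> y"
        using t by auto
    next
      fix x :: real assume "0 \<le> x"
      then show "\<exists>y. (x = y * t \<or> u j = 0) \<and> 0 \<le> y"
        using t by (intro exI[of _ "x / t"]) auto
    qed
    then show "R \<in> (\<lambda>i. cone hull {u i}) ` I"
      using j by blast
  qed
  then show ?thesis
    unfolding P_def[symmetric] by blast
qed

section \<open>Extended coordinates and convex sequences\<close>

text \<open>Setting coordinate \<open>0\<close> to \<open>0\<close> and coordinate \<open>l + 1\<close> to coordinate \<open>l\<close> makes all the
  functionals $\mathbf a_1, \dots, \mathbf a_l$, including the first and the last, second differences.\<close>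

definition ext_coord :: "nat \<Rightarrow> (nat \<Rightarrow> 'l) \<Rightarrow> real ^ 'l::finite \<Rightarrow> nat \<Rightarrow> real" where
  "ext_coord l \<sigma> y j = (if j = 0 then 0 else y $ \<sigma> (min j l))"

definition second_diff :: "nat \<Rightarrow> (nat \<Rightarrow> 'l) \<Rightarrow> nat \<Rightarrow> real ^ 'l::finite \<Rightarrow> real" where
  "second_diff l \<sigma> b y = ext_coord l \<sigma> y (b - 1) - 2 * ext_coord l \<sigma> y b + ext_coord l \<sigma> y (b + 1)"

lemma ext_coord_uminus: "ext_coord l \<sigma> (- y) j = - ext_coord l \<sigma> y j"
  by (simp add: ext_coord_def)

lemma linear_second_diff: "linear (second_diff l \<sigma> b)"
  by (rule linearI) (auto simp: second_diff_def ext_coord_def algebra_simps)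

lemma ext_coord_star_ray:
  assumes "bij_betw \<sigma> {1..l} UNIV" "b \<in> {1..l}"
  shows "ext_coord l \<sigma> (star_ray l \<sigma> b) j = - real (min j b)"
proof (cases "j = 0")
  case False
  define i where "i = min j l"
  have i: "i \<in> {1..l}"
    using False assms by (auto simp: i_def)
  have eq: "axis (\<sigma> k) 1 $ \<sigma> i = (if k = i then 1 else (0::real))" if "k \<in> {1..l}" for k
    using inj_on_eq_iff[OF bij_betw_imp_inj_on[OF assms(1)] that i] by (auto simp: axis_def)
  have "star_ray l \<sigma> b $ \<sigma> i =
      - (\<Sum>k=1..b. real k * (if k = i then 1 else 0)) - (\<Sum>k=b+1..l. real b * (if k = i then 1 else 0))"
    using assms by (simp add: star_ray_def eq cong: sum.cong_simp)
  also have "\<dots> = - real (min i b)"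
    using i by (auto simp: if_distrib[of "(*) _"] cong: if_cong)
  finally show ?thesis
    using False assms by (auto simp: ext_coord_def i_def min_def)
qed (simp add: ext_coord_def)

text \<open>In extended coordinates u_b is the sequence -min(j, b), with slope -1 up to b and 0
  after it, so its only nonzero second difference is at b.\<close>

lemma second_diff_star_ray:
  assumes "bij_betw \<sigma> {1..l} UNIV" "i \<in> {1..l}" "b \<in> {1..l}"
  shows "second_diff l \<sigma> i (star_ray l \<sigma> b) = (if i = b then 1 else 0)"
  using assms(2,3) by (auto simp: second_diff_def ext_coord_star_ray[OF assms(1)] min_def of_nat_diff)

lemma ext_coord_slope_mono:
  assumes "\<And>b. b \<in> {1..l} \<Longrightarrow> 0 \<le> second_diff l \<sigma> b y" "i \<le> j" "j \<le> l"
  shows "ext_coord l \<sigma> y (i + 1) - ext_coord l \<sigma> y i \<le> ext_coord l \<sigma> y (j + 1) - ext_coord l \<sigma> y j"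
  using assms(2,3)
proof (induction j rule: dec_induct)
  case (step j)
  then show ?case
    using assms(1)[of "Suc j"] by (simp add: second_diff_def)
qed simp

text \<open>Slopes increase, and the last one, from l to l + 1, is zero because of the padding at l
  + 1.\<close>

lemma ext_coord_slope_nonpos:
  assumes "\<And>b. b \<in> {1..l} \<Longrightarrow> 0 \<le> second_diff l \<sigma> b y" "0 < l" "i \<le> l"
  shows "ext_coord l \<sigma> y (i + 1) \<le> ext_coord l \<sigma> y i"
  using ext_coord_slope_mono[OF assms(1) assms(3) order.refl] assms(2)
  by (auto simp: ext_coord_def)

text \<open>Slopes to the right of k are at least the slope at k, and those to the left are at most
  that slope, so the sequence stays above the line in both directions.\<close>

lemma ext_coord_tangent:
  assumes pos: "\<And>b. b \<in> {1..l} \<Longrightarrow> 0 \<le> second_diff l \<sigma> b y" and "k < l" "j \<le> l"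
  shows "ext_coord l \<sigma> y k + (real j - real k) * (ext_coord l \<sigma> y (k + 1) - ext_coord l \<sigma> y k)
    \<le> ext_coord l \<sigma> y j"
proof (cases "k \<le> j")
  case True
  then show ?thesis using \<open>j \<le> l\<close>
  proof (induction j rule: dec_induct)
    case (step j)
    then show ?case
      using ext_coord_slope_mono[OF pos, of k j] by (simp add: algebra_simps)
  qed simp
next
  case False
  then have "j \<le> k" by simp
  then show ?thesis
  proof (induction j rule: inc_induct)
    case (step j)
    then show ?case
      using ext_coord_slope_mono[OF pos, of j k] \<open>k < l\<close> by (simp add: algebra_simps)
  qed simp
qed

text \<open>Both \<open>y\<close> and \<open>- y\<close> satisfy the cone inequalities, so the
  extended sequence is nonincreasing and nondecreasing, and it starts at 0.\<close>

lemma second_diff_eq_0_imp: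
  fixes y :: "real ^ 'l::finite"
  assumes bij: "bij_betw \<sigma> {1..l} (UNIV :: 'l set)" and zero: "\<And>b. b \<in> {1..l} \<Longrightarrow> second_diff l \<sigma> b y = 0"
  shows "y = 0"
proof -
  have "0 < l"
    using bij by (cases l) (auto simp: bij_betw_def)
  have "second_diff l \<sigma> b (- y) = 0" if "b \<in> {1..l}" for b
    using linear_neg[OF linear_second_diff, of l \<sigma> b y] zero[OF that] by simp
  then have "ext_coord l \<sigma> y (i + 1) \<le> ext_coord l \<sigma> y i"
    "ext_coord l \<sigma> (- y) (i + 1) \<le> ext_coord l \<sigma> (- y) i" if "i \<le> l" for i
    using ext_coord_slope_nonpos[of l \<sigma> _ i] zero \<open>0 < l\<close> that by simp_all
  then have step: "ext_coord l \<sigma> y (i + 1) = ext_coord l \<sigma> y i" if "i \<le> l" for i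
    using that by (intro antisym) (simp_all add: ext_coord_uminus)
  have "ext_coord l \<sigma> y i = 0" if "i \<le> l" for i
    using that
  proof (induction i)
    case (Suc i)
    then show ?case
      using step[of i] by simp
  qed (simp add: ext_coord_def)
  then have zero: "y $ \<sigma> i = 0" if "i \<in> {1..l}" for i
    using that by (metis atLeastAtMost_iff ext_coord_def min.absorb1 not_one_le_zero)
  show ?thesis
  proof (subst vec_eq_iff, intro allI)
    fix i
    obtain j where "j \<in> {1..l}" "i = \<sigma> j"
      using bij by (metis UNIV_I bij_betw_imp_surj_on imageE)
    then show "y $ i = 0 $ i"
      using zero by simp
  qed
qed

lemma second_diff_cone_iff:
  assumes "l \<ge> 2"
  shows "(\<forall>b\<in>{1..l}. 0 \<le> second_diff l \<sigma> b y) \<longleftrightarrow>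
     - 2 * y $ \<sigma> 1 + y $ \<sigma> 2 \<ge> 0 \<and>
     (\<forall>b\<in>{2..l - 1}. y $ \<sigma> (b - 1) - 2 * y $ \<sigma> b + y $ \<sigma> (b + 1) \<ge> 0) \<and>
     y $ \<sigma> (l - 1) - y $ \<sigma> l \<ge> 0"
proof -
  have "{1..l} = insert 1 (insert l {2..l - 1})"
    using assms by auto
  moreover have "second_diff l \<sigma> 1 y = - 2 * y $ \<sigma> 1 + y $ \<sigma> 2"
    using assms by (simp add: second_diff_def ext_coord_def numeral_2_eq_2)
  moreover have "second_diff l \<sigma> l y = y $ \<sigma> (l - 1) - y $ \<sigma> l"
    using assms by (simp add: second_diff_def ext_coord_def)
  moreover have "second_diff l \<sigma> b y = y $ \<sigma> (b - 1) - 2 * y $ \<sigma> b + y $ \<sigma> (b + 1)"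
    if "b \<in> {2..l - 1}" for b
    using assms that by (auto simp: second_diff_def ext_coord_def min_def)
  ultimately show ?thesis
    by auto
qed

section \<open>Star densities as moments\<close>

text \<open>The link of a c-tuple as a set of ordered tuples, with no injectivity imposed: its
  elements are the ways to extend a map on the common vertices to one edge of the star.\<close>

definition links :: "nat \<Rightarrow> nat \<Rightarrow> 'a hypergraph \<Rightarrow> (nat \<Rightarrow> 'a) \<Rightarrow> (nat \<Rightarrow> 'a) set" where
  "links r c G \<psi> = {\<eta> \<in> {..<r - c} \<rightarrow>\<^sub>E verts G. \<psi> ` {..<c} \<union> \<eta> ` {..<r - c} \<in> edges G}"

definition link_density :: "nat \<Rightarrow> nat \<Rightarrow> 'a hypergraph \<Rightarrow> (nat \<Rightarrow> 'a) \<Rightarrow> real" where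
  "link_density r c G \<psi> = card (links r c G \<psi>) / real (card (verts G)) ^ (r - c)"

lemma finite_links: "finite (verts G) \<Longrightarrow> finite (links r c G \<psi>)"
  unfolding links_def by (simp add: finite_PiE)

lemma image_star_edge:
  "\<phi> ` star_edge r c i = (\<lambda>j. \<phi> (0, j)) ` {..<c} \<union> (\<lambda>j. \<phi> (i, j)) ` {..<r - c}"
  by (auto simp: star_edge_def)

text \<open>Once the image \<open>\<psi>\<close> of the common vertices is fixed, the b edges of the
  star are independent, and each picks an element of the link of \<open>\<psi>\<close>.\<close>

lemma card_homs_star:
  assumes "finite (verts G)"
  shows "card (homs (star r b c) G) = (\<Sum>\<psi>\<in>{..<c} \<rightarrow>\<^sub>E verts G. card (links r c G \<psi>) ^ b)"
proof -
  let ?V = "{0} \<times> {..<c} \<union> {1..b} \<times> {..<r - c}"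
  define T where "T = (SIGMA \<psi>:{..<c} \<rightarrow>\<^sub>E verts G. {1..b} \<rightarrow>\<^sub>E links r c G \<psi>)"
  \<comment> \<open>\<open>f\<close> separates the common part from the private parts and
    \<open>g\<close> glues them back; the restrictions keep all functions extensional, which makes
    the two maps inverse to each other.\<close>
  define f :: "(nat \<times> nat \<Rightarrow> 'a) \<Rightarrow> (nat \<Rightarrow> 'a) \<times> (nat \<Rightarrow> nat \<Rightarrow> 'a)"
    where "f \<phi> = (\<lambda>j\<in>{..<c}. \<phi> (0, j), \<lambda>i\<in>{1..b}. \<lambda>j\<in>{..<r - c}. \<phi> (i, j))" for \<phi>
  define g :: "(nat \<Rightarrow> 'a) \<times> (nat \<Rightarrow> nat \<Rightarrow> 'a) \<Rightarrow> (nat \<times> nat \<Rightarrow> 'a)"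
    where "g = (\<lambda>(\<psi>, F). \<lambda>p\<in>?V. if fst p = 0 then \<psi> (snd p) else F (fst p) (snd p))"
  have homs: "homs (star r b c) G =
     {\<phi> \<in> ?V \<rightarrow>\<^sub>E verts G. \<forall>i\<in>{1..b}. (\<lambda>j. \<phi> (0, j)) ` {..<c} \<union> (\<lambda>j. \<phi> (i, j)) ` {..<r - c} \<in> edges G}"
    by (simp add: homs_def star_def image_star_edge)
  have "bij_betw f (homs (star r b c) G) T"
  proof (rule bij_betw_byWitness[where f' = g])
    show "\<forall>\<phi>\<in>homs (star r b c) G. g (f \<phi>) = \<phi>"
    proof
      fix \<phi> assume "\<phi> \<in> homs (star r b c) G"
      then have "\<phi> \<in> ?V \<rightarrow>\<^sub>E verts G"
        by (simp add: homs)
      then show "g (f \<phi>) = \<phi>"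
        by (intro ext) (auto simp: f_def g_def PiE_def extensional_def)
    qed
    show "\<forall>x\<in>T. f (g x) = x"
    proof
      fix x assume "x \<in> T"
      then obtain \<psi> F where x: "x = (\<psi>, F)" and \<psi>: "\<psi> \<in> {..<c} \<rightarrow>\<^sub>E verts G"
        and F: "F \<in> {1..b} \<rightarrow>\<^sub>E links r c G \<psi>"
        by (auto simp: T_def)
      have "(\<lambda>j\<in>{..<c}. g (\<psi>, F) (0, j)) = \<psi>"
        using \<psi> by (intro ext) (auto simp: g_def PiE_def extensional_def)
      moreover have "(\<lambda>j\<in>{..<r - c}. g (\<psi>, F) (i, j)) = F i" if "i \<in> {1..b}" for i
      proof -
        have "F i \<in> {..<r - c} \<rightarrow>\<^sub>E verts G"
          using F that by (auto simp: links_def)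
        then show ?thesis
          using that by (intro ext) (auto simp: g_def PiE_def extensional_def)
      qed
      then have "(\<lambda>i\<in>{1..b}. \<lambda>j\<in>{..<r - c}. g (\<psi>, F) (i, j)) = F"
        using F by (intro ext) (auto simp: PiE_def extensional_def)
      ultimately show "f (g x) = x"
        by (simp add: f_def x)
    qed
    show "f ` homs (star r b c) G \<subseteq> T"
    proof (rule image_subsetI)
      fix \<phi> assume "\<phi> \<in> homs (star r b c) G"
      then have "\<phi> \<in> ?V \<rightarrow>\<^sub>E verts G"
        and e: "\<And>i. i \<in> {1..b} \<Longrightarrow> (\<lambda>j. \<phi> (0, j)) ` {..<c} \<union> (\<lambda>j. \<phi> (i, j)) ` {..<r - c} \<in> edges G"
        by (simp_all add: homs)
      then have "\<phi> p \<in> verts G" if "p \<in> ?V" for p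
        using that by blast
      then show "f \<phi> \<in> T"
        using e by (auto simp: f_def T_def links_def)
    qed
    show "g ` T \<subseteq> homs (star r b c) G"
    proof (rule image_subsetI)
      fix x assume "x \<in> T"
      then obtain \<psi> F where x: "x = (\<psi>, F)" and \<psi>: "\<psi> \<in> {..<c} \<rightarrow>\<^sub>E verts G"
        and F: "F \<in> {1..b} \<rightarrow>\<^sub>E links r c G \<psi>"
        by (auto simp: T_def)
      have Fi: "F i \<in> {..<r - c} \<rightarrow>\<^sub>E verts G" "\<psi> ` {..<c} \<union> F i ` {..<r - c} \<in> edges G"
        if "i \<in> {1..b}" for i
        using F that by (auto simp: links_def)
      have "g x \<in> ?V \<rightarrow>\<^sub>E verts G"
      proof (rule PiE_I)
        fix p assume p: "p \<in> ?V"
        then consider j where "p = (0, j)" "j < c" | i j where "p = (i, j)" "i \<in> {1..b}" "j < r - c"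
          by auto
        then show "g x p \<in> verts G"
        proof cases
          case 1
          then show ?thesis
            using PiE_mem[OF \<psi>, of j] by (simp add: x g_def)
        next
          case 2
          then show ?thesis
            using PiE_mem[OF Fi(1), of i j] by (simp add: x g_def)
        qed
      next
        fix p assume "p \<notin> ?V"
        then show "g x p = undefined"
          by (simp add: g_def x)
      qed
      moreover have "(\<lambda>j. g x (0, j)) ` {..<c} \<union> (\<lambda>j. g x (i, j)) ` {..<r - c} =
          \<psi> ` {..<c} \<union> F i ` {..<r - c}" if "i \<in> {1..b}" for i
        using that by (intro arg_cong2[of _ _ _ _ "(\<union>)"] image_cong) (auto simp: g_def x)
      ultimately show "g x \<in> homs (star r b c) G"
        using Fi(2) by (auto simp: homs)
    qed
  qed
  then have "card (homs (star r b c) G) = card T"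
    by (rule bij_betw_same_card)
  also have "\<dots> = (\<Sum>\<psi>\<in>{..<c} \<rightarrow>\<^sub>E verts G. card (links r c G \<psi>) ^ b)"
    unfolding T_def using assms
    by (subst card_SigmaI) (auto simp: finite_PiE finite_links card_PiE)
  finally show ?thesis .
qed

lemma hom_density_star:
  assumes "finite (verts G)"
  shows "hom_density (star r b c) G =
    (\<Sum>\<psi>\<in>{..<c} \<rightarrow>\<^sub>E verts G. link_density r c G \<psi> ^ b) / real (card (verts G)) ^ c"
  by (simp add: hom_density_def card_homs_star[OF assms] star_card_verts link_density_def
      sum_divide_distrib power_divide power_add power_mult[symmetric] mult.commute)

lemma link_density_nonneg: "0 \<le> link_density r c G \<psi>"
  by (simp add: link_density_def)

lemma link_density_le_1:
  assumes "finite (verts G)"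
  shows "link_density r c G \<psi> \<le> 1"
proof -
  have "card (links r c G \<psi>) \<le> card ({..<r - c} \<rightarrow>\<^sub>E verts G)"
    using assms by (intro card_mono) (auto simp: links_def finite_PiE)
  then have "card (links r c G \<psi>) \<le> card (verts G) ^ (r - c)"
    by (simp add: card_PiE)
  then have "real (card (links r c G \<psi>)) \<le> real (card (verts G)) ^ (r - c)"
    by (metis of_nat_le_iff of_nat_power)
  then show ?thesis
    by (auto simp: link_density_def divide_le_eq_1)
qed

section \<open>Log-convexity of moments and inclusion in the cone\<close>

text \<open>Cauchy-Schwarz for the vectors x^(k/2) and x^(k/2 + 1), with square roots so that odd k
  is covered.\<close>

lemma sum_power_log_convex:
  fixes x :: "'i \<Rightarrow> real"
  assumes "\<And>i. i \<in> I \<Longrightarrow> 0 \<le> x i"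
  shows "(\<Sum>i\<in>I. x i ^ Suc k)\<^sup>2 \<le> (\<Sum>i\<in>I. x i ^ k) * (\<Sum>i\<in>I. x i ^ Suc (Suc k))"
proof -
  have "(\<Sum>i\<in>I. sqrt (x i ^ k) * (sqrt (x i ^ k) * x i))\<^sup>2
      \<le> (\<Sum>i\<in>I. (sqrt (x i ^ k))\<^sup>2) * (\<Sum>i\<in>I. (sqrt (x i ^ k) * x i)\<^sup>2)"
    by (rule Cauchy_Schwarz_ineq_sum)
  also have "(\<Sum>i\<in>I. sqrt (x i ^ k) * (sqrt (x i ^ k) * x i)) = (\<Sum>i\<in>I. x i ^ Suc k)"
    using assms by (intro sum.cong) (simp_all add: mult.assoc[symmetric])
  also have "(\<Sum>i\<in>I. (sqrt (x i ^ k))\<^sup>2) = (\<Sum>i\<in>I. x i ^ k)"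
    using assms by (intro sum.cong) simp_all
  also have "(\<Sum>i\<in>I. (sqrt (x i ^ k) * x i)\<^sup>2) = (\<Sum>i\<in>I. x i ^ Suc (Suc k))"
    using assms by (intro sum.cong) (simp_all add: power_mult_distrib power2_eq_square)
  finally show ?thesis .
qed

lemma hom_density_star_0:
  assumes "finite (verts G)" "verts G \<noteq> {}"
  shows "hom_density (star r 0 c) G = 1"
  using assms by (simp add: hom_density_star card_PiE)

lemma hom_density_nonneg: "0 \<le> hom_density H G"
  by (simp add: hom_density_def)

lemma hom_density_star_log_convex:
  assumes "finite (verts G)"
  shows "(hom_density (star r (Suc b) c) G)\<^sup>2
    \<le> hom_density (star r b c) G * hom_density (star r (Suc (Suc b)) c) G"
proof -
  let ?I = "{..<c} \<rightarrow>\<^sub>E verts G" and ?N = "real (card (verts G)) ^ c"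
  have "(\<Sum>\<psi>\<in>?I. link_density r c G \<psi> ^ Suc b)\<^sup>2 / ?N\<^sup>2
      \<le> ((\<Sum>\<psi>\<in>?I. link_density r c G \<psi> ^ b) * (\<Sum>\<psi>\<in>?I. link_density r c G \<psi> ^ Suc (Suc b))) / ?N\<^sup>2"
    by (intro divide_right_mono sum_power_log_convex link_density_nonneg) simp
  then show ?thesis
    by (simp add: hom_density_star[OF assms] power_divide power2_eq_square)
qed

lemma hom_density_star_antimono:
  assumes "finite (verts G)"
  shows "hom_density (star r (Suc b) c) G \<le> hom_density (star r b c) G"
  unfolding hom_density_star[OF assms]
  by (intro divide_right_mono sum_mono power_decreasing link_density_nonneg link_density_le_1 assms) simp_all

text \<open>Multiplicative counterpart of \<open>ext_coord\<close>: the value 1 at index 0 is the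
  zeroth moment, and its logarithm is the 0 used there.\<close>

definition ext_moment :: "nat \<Rightarrow> (nat \<Rightarrow> 'l) \<Rightarrow> real ^ 'l::finite \<Rightarrow> nat \<Rightarrow> real" where
  "ext_moment l \<sigma> v j = (if j = 0 then 1 else v $ \<sigma> (min j l))"

lemma continuous_on_ext_moment: "continuous_on S (\<lambda>v. ext_moment l \<sigma> v j)"
  by (cases "j = 0") (auto simp: ext_moment_def intro!: continuous_intros)

lemma ln_ext_moment: "ln (ext_moment l \<sigma> v j) = ext_coord l \<sigma> (\<chi> i. ln (v $ i)) j"
  by (simp add: ext_moment_def ext_coord_def)

text \<open>The inequality is a closed condition, so it suffices to check it for actual densities.
  For b < l it is Cauchy-Schwarz; at b = l the padded moment equals the l-th one, and monotonicity
  of the moments is what is needed.\<close>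

lemma density_profile_log_convex:
  assumes v: "v \<in> density_profile r l \<sigma> (\<lambda>b. star r b c)" and b: "b \<in> {1..l}"
  shows "(ext_moment l \<sigma> v b)\<^sup>2 \<le> ext_moment l \<sigma> v (b - 1) * ext_moment l \<sigma> v (b + 1)"
proof -
  let ?T = "{v. (ext_moment l \<sigma> v b)\<^sup>2 \<le> ext_moment l \<sigma> v (b - 1) * ext_moment l \<sigma> v (b + 1)}"
  have "closed ?T"
    by (intro closed_Collect_le continuous_intros continuous_on_ext_moment)
  moreover have "v \<in> ?T"
    if G: "uniform_hypergraph r G" "verts G \<noteq> {}" "\<forall>b\<in>{1..l}. v $ \<sigma> b = hom_density (star r b c) G"
    for v and G :: "nat hypergraph"
  proof -
    have fin: "finite (verts G)"
      using G by (simp add: uniform_hypergraph_def)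
    have eq: "ext_moment l \<sigma> v j = hom_density (star r j c) G" if "j \<le> l" for j
      using that G hom_density_star_0[OF fin] by (cases "j = 0") (auto simp: ext_moment_def)
    have last: "ext_moment l \<sigma> v (Suc l) = ext_moment l \<sigma> v l"
      using b by (simp add: ext_moment_def)
    obtain k where k: "b = Suc k"
      using b by (cases b) auto
    show ?thesis
    proof (cases "b = l")
      case True
      have "hom_density (star r b c) G * hom_density (star r b c) G
          \<le> hom_density (star r k c) G * hom_density (star r b c) G"
        unfolding k by (intro mult_right_mono hom_density_star_antimono[OF fin] hom_density_nonneg)
      then show ?thesis
        using True k eq[of l] eq[of k] last by (auto simp: power2_eq_square)
    next
      case False
      then show ?thesis
        using b hom_density_star_log_convex[OF fin, of r k c] eq[of b] eq[of k] eq[of "Suc b"]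
        by (simp add: k)
    qed
  qed
  ultimately have "density_profile r l \<sigma> (\<lambda>b. star r b c) \<subseteq> ?T"
    unfolding density_profile_def by (intro closure_minimal) blast+
  then show ?thesis
    using v by blast
qed

text \<open>Logarithms turn log-convexity into a nonnegative second difference. The factor
  \<open>- 1 / ln (\<tau> k)\<close> is positive since \<open>\<tau> k < 1\<close>, and the closed
  half-space contains the limit.\<close>

lemma trop_density_profile_second_diff:
  fixes \<sigma> :: "nat \<Rightarrow> 'l::finite"
  assumes y: "y \<in> trop (density_profile r l \<sigma> (\<lambda>b. star r b c))" and b: "b \<in> {1..l}"
  shows "0 \<le> second_diff l \<sigma> b y"
proof -
  obtain \<tau> :: "nat \<Rightarrow> real" and x :: "nat \<Rightarrow> real ^ 'l" where \<tau>: "\<And>k. 0 < \<tau> k \<and> \<tau> k < 1"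
    and x: "\<And>k. x k \<in> density_profile r l \<sigma> (\<lambda>b. star r b c)" and pos: "\<And>k i. 0 < x k $ i"
    and lim: "(\<lambda>k. (- 1 / ln (\<tau> k)) *\<^sub>R (\<chi> i. ln (x k $ i))) \<longlonglongrightarrow> y"
    using y unfolding trop_def by blast
  have nn: "0 \<le> second_diff l \<sigma> b (\<chi> i. ln (x k $ i))" for k
  proof -
    let ?m = "ext_moment l \<sigma> (x k)"
    have m: "0 < ?m j" for j
      by (simp add: ext_moment_def pos)
    have "ln ((?m b)\<^sup>2) \<le> ln (?m (b - 1) * ?m (b + 1))"
      using density_profile_log_convex[OF x b] m[of b] by (intro ln_mono) simp_all
    also have "\<dots> = ln (?m (b - 1)) + ln (?m (b + 1))"
      using m by (intro ln_mult_pos)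
    finally show ?thesis
      using m[of b] by (simp add: second_diff_def ln_ext_moment[symmetric] ln_realpow)
  qed
  have "closed {y. 0 \<le> second_diff l \<sigma> b y}"
    using linear_continuous_on[OF linear_conv_bounded_linear[THEN iffD1, OF linear_second_diff]]
    by (intro closed_Collect_le continuous_on_const)
  moreover have "0 \<le> second_diff l \<sigma> b ((- 1 / ln (\<tau> k)) *\<^sub>R (\<chi> i. ln (x k $ i)))" for k
    using nn[of k] \<tau>[of k]
    by (simp only: linear_cmul[OF linear_second_diff]) (simp add: divide_nonneg_neg divide_nonpos_neg divide_le_0_iff)
  ultimately show ?thesis
    using closed_sequentially[OF _ _ lim] by blast
qed

section \<open>Layered hypergraphs\<close>

text \<open>In mixed radix a vertex is v = \<rho> + n (u + r p), so the residue \<rho>, the block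
  index u and the number p < k vary independently.\<close>

lemma card_residue_block:
  assumes "\<rho> < n" "u < r"
  shows "card {v. v < n * r * k \<and> v mod n = \<rho> \<and> (v div n) mod r = u} = k"
proof -
  let ?f = "\<lambda>p. \<rho> + n * (u + r * p)"
  have "{v. v < n * r * k \<and> v mod n = \<rho> \<and> (v div n) mod r = u} = ?f ` {..<k}"
  proof (intro subset_antisym subsetI)
    fix v assume "v \<in> {v. v < n * r * k \<and> v mod n = \<rho> \<and> (v div n) mod r = u}"
    then have v: "v < n * r * k" "v mod n = \<rho>" "(v div n) mod r = u"
      by auto
    have "v = ?f (v div n div r)"
      using v by (metis add.commute mult_div_mod_eq)
    moreover have "v div n div r < k"
      using v(1) assms by (metis div_mult2_eq less_mult_imp_div_less mult.commute)
    ultimately show "v \<in> ?f ` {..<k}"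
      by blast
  next
    fix v assume "v \<in> ?f ` {..<k}"
    then obtain p where p: "p < k" and v: "v = ?f p"
      by auto
    have "?f p < n * (u + r * p + 1)"
      using assms by simp
    also have "\<dots> \<le> n * (r * (p + 1))"
      using assms by (intro mult_le_mono2) simp
    also have "\<dots> \<le> n * (r * k)"
      using p by (intro mult_le_mono2) simp
    finally show "v \<in> {v. v < n * r * k \<and> v mod n = \<rho> \<and> (v div n) mod r = u}"
      using assms by (simp add: v mult.assoc)
  qed
  moreover have "inj_on ?f {..<k}"
    using assms by (auto simp: inj_on_def)
  ultimately show ?thesis
    by (simp add: card_image)
qed

lemma card_residue:
  assumes "\<rho> < n"
  shows "card {v. v < n * k \<and> v mod n = \<rho>} = k"
  using card_residue_block[OF assms, of 0 1 k] by simp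

text \<open>Adding z permutes the residues modulo n.\<close>

lemma card_shifted_residues:
  assumes "t \<le> (n::nat)" "0 < n"
  shows "card {\<rho>\<in>{..<n}. (z + \<rho>) mod n < t} = t"
proof -
  let ?f = "\<lambda>\<rho>. (z + \<rho>) mod n"
  have le: "y \<le> x" if "y < n" "(z + x) mod n = (z + y) mod n" for x y
  proof (rule ccontr)
    assume "\<not> y \<le> x"
    with that have "n dvd y - x" "0 < y - x"
      using mod_eq_dvd_iff_nat[of "z + x" "z + y" n] by simp_all
    then have "n \<le> y - x"
      by (rule dvd_imp_le)
    then show False
      using \<open>y < n\<close> by simp
  qed
  have inj: "inj_on ?f {..<n}"
  proof (rule inj_onI)
    fix x y assume "x \<in> {..<n}" "y \<in> {..<n}" "?f x = ?f y"
    then show "x = y"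
      using le[of x y] le[of y x] by simp
  qed
  have surj: "?f ` {..<n} = {..<n}"
    using assms by (intro endo_inj_surj inj) auto
  have "?f ` {\<rho>\<in>{..<n}. ?f \<rho> < t} = {x\<in>?f ` {..<n}. x < t}"
    by blast
  also have "\<dots> = {..<t}"
    unfolding surj using assms(1) by auto
  finally have "card {..<t} = card (?f ` {\<rho>\<in>{..<n}. ?f \<rho> < t})"
    by simp
  also have "\<dots> = card {\<rho>\<in>{..<n}. ?f \<rho> < t}"
    by (rule card_image[OF inj_on_subset[OF inj]]) blast
  finally show ?thesis
    by simp
qed

text \<open>The shifted condition selects exactly t of the n residue classes, whatever z is, and
  each carries the mass \<open>W\<close>.\<close>

lemma sum_residue_condition:
  fixes f :: "nat \<Rightarrow> real" and n t z :: nat and W :: real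
  assumes "finite V" "t \<le> n" "0 < n"
    and W: "\<And>\<rho>. \<rho> < n \<Longrightarrow> (\<Sum>v\<in>{v \<in> V. v mod n = \<rho>}. f v) = W"
  shows "(\<Sum>v\<in>V. f v * of_bool ((z + v) mod n < t)) = t * W"
proof -
  have "(\<Sum>v\<in>V. f v * of_bool ((z + v) mod n < t)) =
      (\<Sum>\<rho><n. \<Sum>v\<in>{v \<in> V. v mod n = \<rho>}. f v * of_bool ((z + v) mod n < t))"
    using assms by (intro sum.group[symmetric]) auto
  also have "\<dots> = (\<Sum>\<rho><n. \<Sum>v\<in>{v \<in> V. v mod n = \<rho>}. f v * of_bool ((z + \<rho>) mod n < t))"
    by (intro sum.cong refl) (auto simp: mod_simps)
  also have "\<dots> = (\<Sum>\<rho><n. W * of_bool ((z + \<rho>) mod n < t))"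
    by (intro sum.cong refl) (simp add: sum_distrib_right[symmetric] W)
  also have "\<dots> = W * card {\<rho>\<in>{..<n}. (z + \<rho>) mod n < t}"
    by (simp add: sum_distrib_left[symmetric] of_bool_def sum.If_cases Int_def)
  finally show ?thesis
    using card_shifted_residues[OF assms(2,3), of z] by (simp add: mult.commute)
qed

lemma sum_residue_total:
  fixes f :: "nat \<Rightarrow> real" and n :: nat and W :: real
  assumes "finite V" "0 < n"
    and W: "\<And>\<rho>. \<rho> < n \<Longrightarrow> (\<Sum>v\<in>{v \<in> V. v mod n = \<rho>}. f v) = W"
  shows "(\<Sum>v\<in>V. f v) = n * W"
proof -
  have "of_bool ((0 + v) mod n < n) = (1::real)" for v
    using \<open>0 < n\<close> by simp
  then show ?thesis
    using sum_residue_condition[OF assms(1) order.refl assms(2) W, where z = 0] by simp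
qed

text \<open>A single coordinate \<open>u0\<close> suffices to equidistribute the sum: for any choice
  of the others it contributes \<open>t * W\<close>, and the others are then unconstrained, each
  with total mass \<open>n * W\<close>.\<close>

lemma sum_PiE_residue_condition:
  fixes w :: "'i \<Rightarrow> nat \<Rightarrow> real" and n t z :: nat and W :: real
  assumes J: "finite J" "J \<noteq> {}" and V: "finite V" and t: "t \<le> n" "0 < n"
    and W: "\<And>u \<rho>. u \<in> J \<Longrightarrow> \<rho> < n \<Longrightarrow> (\<Sum>v\<in>{v \<in> V. v mod n = \<rho>}. w u v) = W"
  shows "(\<Sum>\<eta>\<in>J \<rightarrow>\<^sub>E V. (\<Prod>u\<in>J. w u (\<eta> u)) * of_bool ((z + (\<Sum>u\<in>J. \<eta> u)) mod n < t))
    = t * W * (n * W) ^ (card J - 1)"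
proof -
  obtain u0 where "u0 \<in> J"
    using J by blast
  then obtain K where JK: "J = insert u0 K" and u0: "u0 \<notin> K"
    by (metis mk_disjoint_insert)
  have K: "finite K"
    using J JK by simp
  let ?h = "\<lambda>\<eta>. (\<Prod>u\<in>J. w u (\<eta> u)) * of_bool ((z + (\<Sum>u\<in>J. \<eta> u)) mod n < t)"
  have upd: "?h (\<eta>(u0 := v)) =
      (\<Prod>u\<in>K. w u (\<eta> u)) * (w u0 v * of_bool ((z + (\<Sum>u\<in>K. \<eta> u) + v) mod n < t))" for \<eta> v
  proof -
    have "(\<Prod>u\<in>K. w u ((\<eta>(u0 := v)) u)) = (\<Prod>u\<in>K. w u (\<eta> u))"
      "(\<Sum>u\<in>K. (\<eta>(u0 := v)) u) = (\<Sum>u\<in>K. \<eta> u)"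
      using u0 by (auto intro!: prod.cong sum.cong)
    then show ?thesis
      using u0 K by (simp add: JK ac_simps)
  qed
  have "(\<Sum>\<eta>\<in>J \<rightarrow>\<^sub>E V. ?h \<eta>) = (\<Sum>(v, \<eta>)\<in>V \<times> (K \<rightarrow>\<^sub>E V). ?h (\<eta>(u0 := v)))"
    using inj_combinator[OF u0, of "\<lambda>_. V"]
    by (subst (1) JK, subst PiE_insert_eq, subst sum.reindex) (simp_all add: case_prod_unfold)
  also have "\<dots> = (\<Sum>\<eta>\<in>K \<rightarrow>\<^sub>E V. \<Sum>v\<in>V. ?h (\<eta>(u0 := v)))"
    by (subst sum.swap, subst sum.cartesian_product) simp
  also have "\<dots> = (\<Sum>\<eta>\<in>K \<rightarrow>\<^sub>E V. (\<Prod>u\<in>K. w u (\<eta> u)) * (t * W))"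
    unfolding upd sum_distrib_left[symmetric]
    using W \<open>u0 \<in> J\<close> by (simp add: sum_residue_condition[OF V t])
  also have "\<dots> = (\<Prod>u\<in>K. \<Sum>v\<in>V. w u v) * (t * W)"
    using V K by (simp add: prod_sum_PiE sum_distrib_right)
  also have "(\<Prod>u\<in>K. \<Sum>v\<in>V. w u v) = (n * W) ^ card K"
    using W by (simp add: JK sum_residue_total[OF V t(2)])
  finally show ?thesis
    using u0 K by (simp add: JK)
qed

text \<open>Layer \<open>k\<close> is meant to give normalised degree about \<open>t k / n\<close> to a proportion \<open>(s k / m)^c\<close> of the
  \<open>c\<close>-tuples, namely those inside \<open>{..<n * r * s k}\<close>. The condition on the sum modulo \<open>n\<close> acts as a
  quasirandom sparsification. Since residues modulo \<open>n\<close> are equidistributed on each initial segment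
  \<open>{..<n * r * s}\<close>, it is independent of the condition on the size of the intersection.\<close>

definition layered :: "nat \<Rightarrow> nat \<Rightarrow> nat \<Rightarrow> nat \<Rightarrow> nat \<Rightarrow> (nat \<Rightarrow> nat) \<Rightarrow> (nat \<Rightarrow> nat) \<Rightarrow> nat hypergraph" where
  "layered r c l n m s t = \<lparr>verts = {..<n * r * m},
     edges = {e. e \<subseteq> {..<n * r * m} \<and> card e = r \<and>
       (\<exists>k\<in>{1..l}. c \<le> card (e \<inter> {..<n * r * s k}) \<and> (\<Sum>e) mod n < t k)}\<rparr>"

lemma layered_uniform: "uniform_hypergraph r (layered r c l n m s t)"
  by (auto simp: uniform_hypergraph_def layered_def)

section \<open>Upper bound for the moments of a layered hypergraph\<close>

text \<open>The images have at most as many points as the domains, so equality excludes every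
  collision. For an edge, its size r thus forces the tuples filling it to be injective and
  disjoint.\<close>

lemma card_image_Un_full:
  assumes "finite A" "finite B" "card (f ` A \<union> g ` B) = card A + card B"
  shows "inj_on f A" "inj_on g B" "f ` A \<inter> g ` B = {}"
proof -
  have "card (f ` A) + card (g ` B) = card (f ` A \<union> g ` B) + card (f ` A \<inter> g ` B)"
    using assms by (intro card_Un_Int) auto
  moreover have "card (f ` A) \<le> card A" "card (g ` B) \<le> card B"
    using assms by (auto intro: card_image_le)
  ultimately have "card (f ` A) = card A" "card (g ` B) = card B" "card (f ` A \<inter> g ` B) = 0"
    using assms(3) by linarith+
  then show "inj_on f A" "inj_on g B" "f ` A \<inter> g ` B = {}"
    using assms by (auto intro: eq_card_imp_inj_on)
qed

text \<open>A set of size \<open>r\<close> meeting \<open>{..<M}\<close> in at least \<open>c\<close> points has total weight at least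
  \<open>a ^ (r - c)\<close>, which replaces the count of such sets by a sum that factorises over their points.\<close>

definition weight :: "nat \<Rightarrow> real \<Rightarrow> nat \<Rightarrow> real" where
  "weight M a v = (if v < M then 1 else a)"

lemma weight_bounds: "0 \<le> a \<Longrightarrow> a \<le> 1 \<Longrightarrow> 0 \<le> weight M a v \<and> weight M a v \<le> 1"
  by (simp add: weight_def)

lemma prod_weight:
  assumes "finite e"
  shows "(\<Prod>v\<in>e. weight M a v) = a ^ (card e - card (e \<inter> {..<M}))"
proof -
  have "(\<Prod>v\<in>e. weight M a v) = a ^ card (e \<inter> - {..<M})"
    using assms unfolding weight_def by (subst prod.If_cases) (auto simp: lessThan_def)
  also have "e \<inter> - {..<M} = e - e \<inter> {..<M}"
    by auto
  finally show ?thesis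
    using assms by (simp add: card_Diff_subset)
qed

text \<open>Exactly k of the m points of each residue class lie below \<open>n * k\<close>, so all
  classes have the same mass, as the factorised sums require.\<close>

lemma sum_weight_residue:
  assumes "\<rho> < n" "k \<le> m"
  shows "(\<Sum>v\<in>{v \<in> {..<n * m}. v mod n = \<rho>}. weight (n * k) a v) = real k + a * (real m - real k)"
proof -
  let ?S = "{v \<in> {..<n * m}. v mod n = \<rho>}"
  have le: "n * k \<le> n * m"
    using assms by simp
  have 1: "?S \<inter> {v. v < n * k} = {v. v < n * k \<and> v mod n = \<rho>}"
    by (auto intro: less_le_trans[OF _ le])
  have "?S \<inter> - {v. v < n * k} = {v. v < n * m \<and> v mod n = \<rho>} - {v. v < n * k \<and> v mod n = \<rho>}"
    by auto
  moreover have sub: "{v. v < n * k \<and> v mod n = \<rho>} \<subseteq> {v. v < n * m \<and> v mod n = \<rho>}"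
    by (auto intro: less_le_trans[OF _ le])
  ultimately have 2: "card (?S \<inter> - {v. v < n * k}) = m - k"
    using assms by (simp add: card_Diff_subset card_residue sub)
  show ?thesis
    unfolding weight_def using assms 1 2
    by (subst sum.If_cases) (simp_all add: card_residue of_nat_diff)
qed

text \<open>For each counted \<open>\<eta>\<close> the weights of the r points of the edge multiply
  to at least a^(r - c), where a = s / m. Dividing each of the r - c weights of
  \<open>\<eta>\<close> by a therefore gives a factorising majorant of the count. Each point of
  \<open>\<psi>\<close> outside the initial segment contributes a factor s / m.\<close>

lemma layered_links_single_le:
  fixes r c m n s t :: nat
  assumes c: "c < r" and s: "0 < s" "s \<le> m" and t: "t \<le> n" "0 < n"
  shows "real (card {\<eta> \<in> {..<r - c} \<rightarrow>\<^sub>E {..<n * r * m}.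
      card (\<psi> ` {..<c} \<union> \<eta> ` {..<r - c}) = r \<and>
      c \<le> card ((\<psi> ` {..<c} \<union> \<eta> ` {..<r - c}) \<inter> {..<n * r * s}) \<and>
      (\<Sum>(\<psi> ` {..<c} \<union> \<eta> ` {..<r - c})) mod n < t})
    \<le> (\<Prod>j<c. weight (n * r * s) (s / m) (\<psi> j)) * ((2 ^ (r - c) * (t / n)) * real (n * r * m) ^ (r - c))"
    (is "real (card ?L) \<le> ?P * _")
proof -
  define a where "a = real s / m"
  have a: "0 < a" "a \<le> 1"
    using s by (auto simp: a_def)
  define g where "g = weight (n * r * s) a"
  have g: "0 \<le> g v" for v
    using a by (simp add: g_def weight_bounds)
  let ?D = "{..<r - c}" and ?V = "{..<n * r * m}"
  let ?h = "\<lambda>\<eta>. (\<Prod>u\<in>?D. g (\<eta> u) / a) * of_bool (((\<Sum>j<c. \<psi> j) + (\<Sum>u\<in>?D. \<eta> u)) mod n < t)"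
  \<comment> \<open>Mass of the rescaled weight in a residue class. The choice a = s / m makes the
    first term equal to r * m, so W is at most twice the size r * m of the class.\<close>
  define W where "W = real (r * s) / a + (real (r * m) - real (r * s))"
  have "(\<Sum>\<eta>\<in>?D \<rightarrow>\<^sub>E ?V. ?h \<eta>) = t * W * (n * W) ^ (card ?D - 1)"
  proof (rule sum_PiE_residue_condition)
    fix u \<rho> assume "\<rho> < n"
    have "(\<Sum>v\<in>{v \<in> ?V. v mod n = \<rho>}. g v / a) = (\<Sum>v\<in>{v \<in> {..<n * (r * m)}. v mod n = \<rho>}. weight (n * (r * s)) a v) / a"
      by (simp add: g_def sum_divide_distrib mult.assoc)
    also have "\<dots> = W"
      using \<open>\<rho> < n\<close> s a by (subst sum_weight_residue) (auto simp: W_def field_simps)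
    finally show "(\<Sum>v\<in>{v \<in> ?V. v mod n = \<rho>}. g v / a) = W" .
  qed (use c t in \<open>auto simp: lessThan_empty_iff\<close>)
  also have "\<dots> \<le> real t * (2 * real (r * m)) * (real n * (2 * real (r * m))) ^ (card ?D - 1)"
  proof -
    have "real (r * s) / a = real (r * m)"
      using s by (simp add: a_def)
    moreover have "real (r * s) \<le> real (r * m)"
      using s by (intro of_nat_mono) simp
    moreover have "0 \<le> real (r * s)"
      by (rule of_nat_0_le_iff)
    ultimately have W: "0 \<le> W" "W \<le> 2 * real (r * m)"
      unfolding W_def by linarith+
    have "real t * W \<le> real t * (2 * real (r * m))" "real n * W \<le> real n * (2 * real (r * m))"
      by (intro mult_left_mono W of_nat_0_le_iff)+
    then show ?thesis
      by (rule mult_mono[OF _ power_mono]) (simp_all add: W)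
  qed
  also have "\<dots> = (2 ^ (r - c) * (t / n)) * real (n * r * m) ^ (r - c)"
  proof -
    obtain d where d: "r - c = Suc d"
      using c by (metis Suc_diff_Suc)
    show ?thesis
      using t by (simp add: d power_mult_distrib)
  qed
  finally have total: "(\<Sum>\<eta>\<in>?D \<rightarrow>\<^sub>E ?V. ?h \<eta>) \<le> (2 ^ (r - c) * (t / n)) * real (n * r * m) ^ (r - c)" .
  have "real (card ?L) = (\<Sum>\<eta>\<in>?L. 1)"
    by simp
  also have "\<dots> \<le> (\<Sum>\<eta>\<in>?L. (\<Prod>j<c. g (\<psi> j)) * ?h \<eta>)"
  proof (rule sum_mono)
    fix \<eta> assume \<eta>: "\<eta> \<in> ?L"
    let ?e = "\<psi> ` {..<c} \<union> \<eta> ` ?D"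
    have \<eta>': "card ?e = r" "c \<le> card (?e \<inter> {..<n * r * s})" "\<Sum>?e mod n < t"
      using \<eta> by simp_all
    have inj: "inj_on \<psi> {..<c}" "inj_on \<eta> ?D" "\<psi> ` {..<c} \<inter> \<eta> ` ?D = {}"
      using card_image_Un_full[of "{..<c}" ?D \<psi> \<eta>] \<eta>'(1) c by simp_all
    have sum: "\<Sum>?e = (\<Sum>j<c. \<psi> j) + (\<Sum>u\<in>?D. \<eta> u)"
      using inj by (simp add: sum.union_disjoint sum.reindex)
    have "(\<Prod>j<c. g (\<psi> j)) * (\<Prod>u\<in>?D. g (\<eta> u)) = (\<Prod>v\<in>?e. g v)"
      using inj by (simp add: prod.union_disjoint prod.reindex)
    also have "\<dots> = a ^ (r - card (?e \<inter> {..<n * r * s}))"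
      unfolding g_def using \<eta>'(1) by (subst prod_weight) simp_all
    also have "\<dots> \<ge> a ^ (r - c)"
      using \<eta>'(2) a by (intro power_decreasing) simp_all
    finally have "a ^ (r - c) \<le> (\<Prod>j<c. g (\<psi> j)) * (\<Prod>u\<in>?D. g (\<eta> u))" .
    then have "1 \<le> (\<Prod>j<c. g (\<psi> j)) * (\<Prod>u\<in>?D. g (\<eta> u) / a)"
      using a by (simp add: prod_dividef pos_le_divide_eq)
    moreover have "((\<Sum>j<c. \<psi> j) + (\<Sum>u\<in>?D. \<eta> u)) mod n < t"
      using \<eta>'(3) unfolding sum .
    ultimately show "1 \<le> (\<Prod>j<c. g (\<psi> j)) * ?h \<eta>"
      by simp
  qed
  also have "\<dots> \<le> (\<Sum>\<eta>\<in>?D \<rightarrow>\<^sub>E ?V. (\<Prod>j<c. g (\<psi> j)) * ?h \<eta>)"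
    using g a by (intro sum_mono2 mult_nonneg_nonneg prod_nonneg ballI divide_nonneg_pos finite_PiE) simp_all
  also have "\<dots> = (\<Prod>j<c. g (\<psi> j)) * (\<Sum>\<eta>\<in>?D \<rightarrow>\<^sub>E ?V. ?h \<eta>)"
    by (simp add: sum_distrib_left)
  also have "\<dots> \<le> (\<Prod>j<c. g (\<psi> j)) * ((2 ^ (r - c) * (t / n)) * real (n * r * m) ^ (r - c))"
    using g by (intro mult_left_mono total prod_nonneg) simp
  finally show ?thesis
    by (simp add: g_def a_def)
qed

lemma layered_card_verts: "card (verts (layered r c l n m s t)) = n * r * m"
  by (simp add: layered_def)

text \<open>The sum is at most \<open>card K\<close> times its largest term, and the power of that
  term is one of the summands on the right.\<close>

lemma power_sum_le:
  fixes f :: "'i \<Rightarrow> real"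
  assumes "finite K" "\<And>k. k \<in> K \<Longrightarrow> 0 \<le> f k" "0 < b"
  shows "(\<Sum>k\<in>K. f k) ^ b \<le> real (card K) ^ b * (\<Sum>k\<in>K. f k ^ b)"
proof (cases "K = {}")
  case False
  then have "Max (f ` K) \<in> f ` K"
    using assms(1) by (intro Max_in) simp_all
  then obtain k where k: "k \<in> K" and "f k = Max (f ` K)"
    by force
  then have max: "f j \<le> f k" if "j \<in> K" for j
    using that assms(1) by simp
  have "(\<Sum>k\<in>K. f k) ^ b \<le> (real (card K) * f k) ^ b"
    using assms max by (intro power_mono sum_bounded_above sum_nonneg) simp_all
  also have "\<dots> \<le> real (card K) ^ b * (\<Sum>k\<in>K. f k ^ b)"
    unfolding power_mult_distrib using assms k
    by (intro mult_left_mono member_le_sum) simp_all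
  finally show ?thesis .
qed (use assms in \<open>simp add: zero_power\<close>)

text \<open>The mean weight is s/m + (s/m)(1 - s/m): the vertices outside the segment add no more
  than those inside, so tuples partly outside change the average by a constant factor only.\<close>

lemma sum_PiE_prod_weight_le:
  assumes "0 < n" "0 < m" "s \<le> m"
  shows "(\<Sum>\<psi>\<in>{..<c} \<rightarrow>\<^sub>E {..<n * r * m}. \<Prod>j<c. weight (n * r * s) (s / m) (\<psi> j))
    \<le> (2 * (s / m) * real (n * r * m)) ^ c"
proof -
  define W where "W = real (r * s) + real s / m * (real (r * m) - real (r * s))"
  have "(\<Sum>v\<in>{..<n * (r * m)}. weight (n * (r * s)) (s / m) v) = real n * W"
    unfolding W_def using assms by (intro sum_residue_total sum_weight_residue) simp_all
  moreover have "W \<le> real (r * s) + real s / m * real (r * m)"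
    unfolding W_def by (intro add_left_mono mult_left_mono) simp_all
  then have "W \<le> 2 * (real s / m) * real (r * m)"
    using assms by (simp add: mult.commute)
  moreover have "0 \<le> W"
    unfolding W_def using assms by (intro add_nonneg_nonneg mult_nonneg_nonneg) (simp_all add: mult_left_mono)
  moreover have "{..<n * r * m} = {..<n * (r * m)}" "n * r * s = n * (r * s)"
    by (simp_all only: mult.assoc)
  ultimately have "(\<Sum>v\<in>{..<n * r * m}. weight (n * r * s) (s / m) v) ^ c
      \<le> (real n * (2 * (real s / m) * real (r * m))) ^ c"
    by (simp only:) (intro power_mono mult_left_mono mult_nonneg_nonneg of_nat_0_le_iff)
  then show ?thesis
    using prod_sum_PiE[of "{..<c}" "\<lambda>_. {..<n * r * m}" "\<lambda>_. weight (n * r * s) (s / m)"] assms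
    by (simp add: ac_simps)
qed

lemma layered_link_density_le:
  assumes c: "c < r" and n: "0 < n" and m: "0 < m"
    and s: "\<And>k. k \<in> {1..l} \<Longrightarrow> 0 < s k \<and> s k \<le> m" and t: "\<And>k. k \<in> {1..l} \<Longrightarrow> t k \<le> n"
  shows "link_density r c (layered r c l n m s t) \<psi> \<le>
    (\<Sum>k=1..l. 2 ^ (r - c) * (t k / n) * (\<Prod>j<c. weight (n * r * s k) (s k / m) (\<psi> j)))"
proof -
  let ?e = "\<lambda>\<eta>. \<psi> ` {..<c} \<union> \<eta> ` {..<r - c}"
  let ?L = "\<lambda>k. {\<eta> \<in> {..<r - c} \<rightarrow>\<^sub>E {..<n * r * m}.
      card (?e \<eta>) = r \<and> c \<le> card (?e \<eta> \<inter> {..<n * r * s k}) \<and> (\<Sum>(?e \<eta>)) mod n < t k}"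
  let ?P = "\<lambda>k. \<Prod>j<c. weight (n * r * s k) (s k / m) (\<psi> j)"
  define N where "N = real (n * r * m) ^ (r - c)"
  have N: "0 < N"
    using c n m by (simp add: N_def)
  have "links r c (layered r c l n m s t) \<psi> \<subseteq> (\<Union>k\<in>{1..l}. ?L k)"
    unfolding links_def layered_def by auto
  then have "card (links r c (layered r c l n m s t) \<psi>) \<le> card (\<Union>k\<in>{1..l}. ?L k)"
    by (intro card_mono) (simp_all add: finite_PiE)
  also have "\<dots> \<le> (\<Sum>k=1..l. card (?L k))"
    by (rule card_UN_le) simp
  finally have "real (card (links r c (layered r c l n m s t) \<psi>)) \<le> (\<Sum>k=1..l. real (card (?L k)))"
    by (simp only: of_nat_sum[symmetric] of_nat_le_iff)
  also have "\<dots> \<le> (\<Sum>k=1..l. ?P k * ((2 ^ (r - c) * (t k / n)) * N))"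
    unfolding N_def using s t by (intro sum_mono layered_links_single_le c n) simp_all
  also have "\<dots> = (\<Sum>k=1..l. 2 ^ (r - c) * (t k / n) * ?P k) * N"
    by (simp only: sum_distrib_right) (simp add: ac_simps)
  finally have "real (card (links r c (layered r c l n m s t) \<psi>)) / N
      \<le> (\<Sum>k=1..l. 2 ^ (r - c) * (t k / n) * ?P k)"
    using N by (simp only: pos_divide_le_eq)
  then show ?thesis
    by (simp only: link_density_def N_def) (simp add: layered_def)
qed

text \<open>Raising the bound on link densities to the power b costs l^b for the sum over layers.
  The products of weights lie in [0, 1], so their b-th powers are at most the products themselves,
  whose average over \<open>\<psi>\<close> is at most (2 s/m)^c independently of b.\<close>

lemma layered_density_le:
  assumes c: "c < r" and n: "0 < n" and m: "0 < m" and b: "0 < b"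
    and s: "\<And>k. k \<in> {1..l} \<Longrightarrow> 0 < s k \<and> s k \<le> m" and t: "\<And>k. k \<in> {1..l} \<Longrightarrow> t k \<le> n"
  shows "hom_density (star r b c) (layered r c l n m s t)
    \<le> real l ^ b * (2 ^ (r - c)) ^ b * 2 ^ c * (\<Sum>k=1..l. (s k / m) ^ c * (t k / n) ^ b)"
proof -
  let ?G = "layered r c l n m s t" and ?I = "{..<c} \<rightarrow>\<^sub>E {..<n * r * m}"
  define P where "P k \<psi> = (\<Prod>j<c. weight (n * r * s k) (s k / m) (\<psi> j))" for k and \<psi> :: "nat \<Rightarrow> nat"
  define N where "N = real (n * r * m)"
  have N: "0 < N"
    using c n m by (simp add: N_def)
  have P: "0 \<le> P k \<psi>" "P k \<psi> \<le> 1" if "k \<in> {1..l}" for k \<psi>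
    unfolding P_def using s[OF that] weight_bounds[of "s k / m"]
    by (auto intro!: prod_nonneg prod_le_1)
  have "link_density r c ?G \<psi> ^ b \<le>
      real l ^ b * (2 ^ (r - c)) ^ b * (\<Sum>k=1..l. (t k / n) ^ b * P k \<psi>)" for \<psi>
  proof -
    have "link_density r c ?G \<psi> ^ b \<le> (\<Sum>k=1..l. 2 ^ (r - c) * (t k / n) * P k \<psi>) ^ b"
      unfolding P_def by (intro power_mono layered_link_density_le c n m s t link_density_nonneg)
    also have "\<dots> \<le> real (card {1..l}) ^ b * (\<Sum>k=1..l. (2 ^ (r - c) * (t k / n) * P k \<psi>) ^ b)"
      by (intro power_sum_le b mult_nonneg_nonneg P) simp_all
    also have "\<dots> \<le> real l ^ b * (\<Sum>k=1..l. (2 ^ (r - c)) ^ b * ((t k / n) ^ b * P k \<psi>))"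
    proof (simp only: card_atLeastAtMost diff_Suc_1, intro mult_left_mono sum_mono)
      fix k assume "k \<in> {1..l}"
      then have "P k \<psi> ^ b \<le> P k \<psi> ^ 1"
        using P b by (intro power_decreasing) simp_all
      then show "(2 ^ (r - c) * (t k / n) * P k \<psi>) ^ b \<le> (2 ^ (r - c)) ^ b * ((t k / n) ^ b * P k \<psi>)"
        unfolding power_mult_distrib mult.assoc by (intro mult_left_mono) simp_all
    qed simp
    finally show ?thesis
      by (simp only: sum_distrib_left mult.assoc)
  qed
  then have "(\<Sum>\<psi>\<in>?I. link_density r c ?G \<psi> ^ b)
      \<le> (\<Sum>\<psi>\<in>?I. real l ^ b * (2 ^ (r - c)) ^ b * (\<Sum>k=1..l. (t k / n) ^ b * P k \<psi>))"
    by (intro sum_mono)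
  also have "\<dots> = real l ^ b * (2 ^ (r - c)) ^ b * (\<Sum>k=1..l. (t k / n) ^ b * (\<Sum>\<psi>\<in>?I. P k \<psi>))"
    unfolding sum_distrib_left[symmetric] by (subst sum.swap) (simp only: sum_distrib_left)
  also have "\<dots> \<le> real l ^ b * (2 ^ (r - c)) ^ b * (\<Sum>k=1..l. (t k / n) ^ b * (2 * (s k / m) * N) ^ c)"
    unfolding P_def N_def using s n m
    by (intro mult_left_mono sum_mono sum_PiE_prod_weight_le) simp_all
  also have "\<dots> = real l ^ b * (2 ^ (r - c)) ^ b * 2 ^ c * (\<Sum>k=1..l. (s k / m) ^ c * (t k / n) ^ b) * N ^ c"
    by (simp only: sum_distrib_left sum_distrib_right power_mult_distrib) (simp only: ac_simps)
  finally have "(\<Sum>\<psi>\<in>?I. link_density r c ?G \<psi> ^ b) / N ^ c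
     \<le> real l ^ b * (2 ^ (r - c)) ^ b * 2 ^ c * (\<Sum>k=1..l. (s k / m) ^ c * (t k / n) ^ b)"
    using N by (simp only: pos_divide_le_eq zero_less_power)
  moreover have "verts ?G = {..<n * r * m}"
    by (simp add: layered_def)
  ultimately show ?thesis
    by (simp only: hom_density_star finite_lessThan card_lessThan N_def)
qed

section \<open>Lower bound for the moments of a layered hypergraph\<close>

lemma sum_block_residue:
  assumes "\<rho> < n" "u < r"
  shows "(\<Sum>v\<in>{v \<in> {..<n * r * k}. v mod n = \<rho>}. of_bool ((v div n) mod r = u)) = real k"
proof -
  have "{v \<in> {..<n * r * k}. v mod n = \<rho>} \<inter> {v. (v div n) mod r = u} =
      {v. v < n * r * k \<and> v mod n = \<rho> \<and> (v div n) mod r = u}"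
    by blast
  then show ?thesis
    using card_residue_block[OF assms, of k] by (simp add: of_bool_def sum.If_cases)
qed

lemma card_block:
  assumes "0 < n" "u < r"
  shows "card {v \<in> {..<n * r * k}. (v div n) mod r = u} = n * k"
proof -
  have "(\<Sum>v\<in>{..<n * r * k}. of_bool ((v div n) mod r = u)) = real n * real k"
    using assms by (intro sum_residue_total sum_block_residue) simp_all
  moreover have "(\<Sum>v\<in>{..<n * r * k}. of_bool ((v div n) mod r = u)) =
      real (card {v \<in> {..<n * r * k}. (v div n) mod r = u})"
    by (simp add: of_bool_def sum.If_cases Int_def)
  ultimately show ?thesis
    by (simp only: of_nat_mult[symmetric] of_nat_eq_iff)
qed

lemma prod_of_bool:
  assumes "finite J"
  shows "(\<Prod>u\<in>J. of_bool (P u)) = (of_bool (\<forall>u\<in>J. P u) :: real)"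
  using assms by (induction rule: finite_induct) auto

text \<open>Position \<open>j\<close> of an edge is restricted to the vertices \<open>v\<close> with \<open>(v div n) mod r = j\<close>, so that
  the tuples counted here are injective; this costs only a constant factor.\<close>

lemma layered_link_density_ge:
  assumes c: "c < r" and n: "0 < n" and m: "0 < m" and k: "k \<in> {1..l}" and sk: "s k \<le> m" and tk: "t k \<le> n"
    and \<psi>: "\<psi> \<in> (\<Pi>\<^sub>E j\<in>{..<c}. {v \<in> {..<n * r * s k}. (v div n) mod r = j})"
  shows "t k / n / real r ^ (r - c) \<le> link_density r c (layered r c l n m s t) \<psi>"
proof -
  let ?D = "{..<r - c}" and ?V = "{..<n * r * m}"
  let ?b = "\<lambda>\<eta> :: nat \<Rightarrow> nat. \<forall>u\<in>?D. (\<eta> u div n) mod r = c + u"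
  let ?q = "\<lambda>\<eta> :: nat \<Rightarrow> nat. ((\<Sum>j<c. \<psi> j) + (\<Sum>u\<in>?D. \<eta> u)) mod n < t k"
  define H where "H = {\<eta> \<in> ?D \<rightarrow>\<^sub>E ?V. ?b \<eta> \<and> ?q \<eta>}"
  have \<psi>1: "\<psi> j < n * r * s k" "(\<psi> j div n) mod r = j" if "j < c" for j
    using PiE_mem[OF \<psi>, of j] that by auto
  have sub: "n * r * s k \<le> n * r * m"
    using sk by simp
  have "H \<subseteq> links r c (layered r c l n m s t) \<psi>"
  proof
    fix \<eta> assume "\<eta> \<in> H"
    then have \<eta>: "\<eta> \<in> ?D \<rightarrow>\<^sub>E ?V" and b: "\<And>u. u < r - c \<Longrightarrow> (\<eta> u div n) mod r = c + u" and q: "?q \<eta>"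
      by (simp_all add: H_def)
    let ?e = "\<psi> ` {..<c} \<union> \<eta> ` ?D"
    \<comment> \<open>\<open>\<psi>\<close> uses the blocks 0, ..., c - 1 and \<open>\<eta>\<close>
      the blocks c, ..., r - 1, so the block index recovers the position and the two images cannot
      meet.\<close>
    have inj\<psi>: "inj_on \<psi> {..<c}"
      by (rule inj_on_inverseI[where g = "\<lambda>v. (v div n) mod r"]) (simp add: \<psi>1)
    have inj\<eta>: "inj_on \<eta> ?D"
      by (rule inj_on_inverseI[where g = "\<lambda>v. (v div n) mod r - c"]) (simp add: b)
    have disj: "\<psi> ` {..<c} \<inter> \<eta> ` ?D = {}"
    proof (rule ccontr)
      assume "\<psi> ` {..<c} \<inter> \<eta> ` ?D \<noteq> {}"
      then obtain j u where ju: "j < c" "u < r - c" "\<psi> j = \<eta> u"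
        by blast
      then have "j = c + u"
        using \<psi>1(2) b by metis
      then show False
        using ju by simp
    qed
    have "card ?e = r"
      using inj\<psi> inj\<eta> disj c by (simp add: card_Un_disjoint card_image)
    moreover have "\<Sum>?e mod n < t k"
      using inj\<psi> inj\<eta> disj q by (simp add: sum.union_disjoint sum.reindex)
    moreover have "?e \<subseteq> ?V"
    proof (rule Un_least)
      show "\<psi> ` {..<c} \<subseteq> ?V"
        using \<psi>1(1) sub by (force intro: less_le_trans)
      show "\<eta> ` ?D \<subseteq> ?V"
        using \<eta> by blast
    qed
    moreover have "c \<le> card (?e \<inter> {..<n * r * s k})"
    proof -
      have "card (\<psi> ` {..<c}) \<le> card (?e \<inter> {..<n * r * s k})"
        using \<psi>1(1) by (intro card_mono) auto
      then show ?thesis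
        using inj\<psi> by (simp add: card_image)
    qed
    ultimately have "?e \<in> edges (layered r c l n m s t)"
      using k by (simp only: layered_def hypergraph.simps mem_Collect_eq) blast
    then show "\<eta> \<in> links r c (layered r c l n m s t) \<psi>"
      using \<eta> by (simp only: links_def mem_Collect_eq) (simp add: layered_def)
  qed
  then have le: "card H \<le> card (links r c (layered r c l n m s t) \<psi>)"
    by (intro card_mono finite_links) (simp_all add: layered_def)
  have "real (card H) = (\<Sum>\<eta>\<in>?D \<rightarrow>\<^sub>E ?V. of_bool (?b \<eta>) * of_bool (?q \<eta>))"
    unfolding of_bool_conj[symmetric] H_def
    by (simp only: of_bool_def sum.If_cases finite_PiE finite_lessThan) (simp add: Int_def)
  \<comment> \<open>The block condition is a product weight with mass m in every residue class, so
    the sum modulo n stays equidistributed under it.\<close>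
  also have "\<dots> = (\<Sum>\<eta>\<in>?D \<rightarrow>\<^sub>E ?V. (\<Prod>u\<in>?D. of_bool ((\<eta> u div n) mod r = c + u)) * of_bool (?q \<eta>))"
    by (simp only: prod_of_bool finite_lessThan)
  also have "\<dots> = t k * real m * (n * real m) ^ (card ?D - 1)"
    using c n tk by (intro sum_PiE_residue_condition sum_block_residue) (simp_all add: lessThan_empty_iff)
  also have "\<dots> = t k / n * (real n * real m) ^ (r - c)"
  proof -
    obtain d where d: "r - c = Suc d"
      using c by (metis Suc_diff_Suc)
    show ?thesis
      using n by (simp add: d)
  qed
  finally have "t k / n * (real n * real m) ^ (r - c) \<le> card (links r c (layered r c l n m s t) \<psi>)"
    using le by linarith
  then have "t k / n * (real n * real m) ^ (r - c) / real (n * r * m) ^ (r - c)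
      \<le> link_density r c (layered r c l n m s t) \<psi>"
    unfolding link_density_def by (simp only: layered_card_verts) (intro divide_right_mono; simp)
  moreover have "t k / n * (real n * real m) ^ (r - c) / real (n * r * m) ^ (r - c) = t k / n / real r ^ (r - c)"
    using n m by (simp add: power_mult_distrib)
  ultimately show ?thesis
    by linarith
qed

text \<open>Only the \<open>\<psi>\<close> with j-th entry in block j of the k-th segment are kept.
  They form a share (s k / (r * m))^c of all tuples, and the powers of r on the right pay for the
  block restrictions.\<close>

lemma layered_density_ge:
  assumes c: "c < r" and n: "0 < n" and m: "0 < m" and k: "k \<in> {1..l}" and sk: "s k \<le> m" and tk: "t k \<le> n"
  shows "(s k / m) ^ c * (t k / n) ^ b
    \<le> real r ^ c * (real r ^ (r - c)) ^ b * hom_density (star r b c) (layered r c l n m s t)"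
proof -
  let ?G = "layered r c l n m s t"
  let ?B = "\<Pi>\<^sub>E j\<in>{..<c}. {v \<in> {..<n * r * s k}. (v div n) mod r = j}"
  define x where "x = t k / n / real r ^ (r - c)"
  define N where "N = real (n * r * m)"
  have N: "0 < N"
    using c n m by (simp add: N_def)
  have sub: "n * r * s k \<le> n * r * m"
    using sk by simp
  have cardB: "card ?B = (n * s k) ^ c"
  proof -
    have "card ?B = (\<Prod>j<c. card {v \<in> {..<n * r * s k}. (v div n) mod r = j})"
      by (simp add: card_PiE)
    also have "\<dots> = (\<Prod>j<c. n * s k)"
      using c n by (intro prod.cong card_block) simp_all
    finally show ?thesis
      by simp
  qed
  have "real ((n * s k) ^ c) * x ^ b = (\<Sum>\<psi>\<in>?B. x ^ b)"
    by (simp only: sum_constant cardB)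
  also have "\<dots> \<le> (\<Sum>\<psi>\<in>?B. link_density r c ?G \<psi> ^ b)"
    unfolding x_def by (intro sum_mono power_mono layered_link_density_ge assms) simp_all
  also have "\<dots> \<le> (\<Sum>\<psi>\<in>{..<c} \<rightarrow>\<^sub>E {..<n * r * m}. link_density r c ?G \<psi> ^ b)"
  proof (intro sum_mono2 PiE_mono)
    show "{v \<in> {..<n * r * s k}. (v div n) mod r = j} \<subseteq> {..<n * r * m}" for j
      by (auto intro: less_le_trans[OF _ sub])
  qed (simp_all add: finite_PiE link_density_nonneg)
  finally have "real ((n * s k) ^ c) * x ^ b / N ^ c \<le> hom_density (star r b c) ?G"
    unfolding N_def by (subst hom_density_star) (simp_all add: layered_def divide_right_mono)
  then have "real r ^ c * (real r ^ (r - c)) ^ b * (real ((n * s k) ^ c) * x ^ b / N ^ c)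
      \<le> real r ^ c * (real r ^ (r - c)) ^ b * hom_density (star r b c) ?G"
    by (intro mult_left_mono) simp_all
  moreover have "real r ^ c * (real r ^ (r - c)) ^ b * (real ((n * s k) ^ c) * x ^ b / N ^ c) =
      (s k / m) ^ c * (t k / n) ^ b"
  proof -
    have shuffle: "p * q * (u * v / w) = p * u / w * (q * v)" for p q u v w :: real
      by simp
    have "(real r ^ (r - c)) ^ b * x ^ b = (t k / n) ^ b"
      using c by (simp add: power_mult_distrib[symmetric] x_def)
    moreover have "real r ^ c * real ((n * s k) ^ c) / N ^ c = (s k / m) ^ c"
      using c n m by (simp add: power_mult_distrib[symmetric] power_divide[symmetric] N_def)
    ultimately show ?thesis
      by (metis (no_types) shuffle)
  qed
  ultimately show ?thesis
    by linarith
qed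

section \<open>Realizing the cone\<close>

text \<open>As M * x is at least 1, rounding it up at most doubles it.\<close>

lemma nat_ceiling_approx:
  fixes x :: real and M :: nat
  assumes "0 < x" "x \<le> 1" "1 / x \<le> M"
  defines "s \<equiv> nat \<lceil>M * x\<rceil>"
  shows "0 < s" "s \<le> M" "x \<le> s / M" "s / M \<le> 2 * x"
proof -
  have "0 < 1 / x"
    using assms by simp
  with assms have M: "0 < real M"
    by linarith
  have Mx: "1 \<le> M * x"
    using assms by (simp add: divide_le_eq)
  then have s: "real s = of_int \<lceil>M * x\<rceil>"
    unfolding s_def by simp
  have "M * x \<le> s" "s < M * x + 1"
    unfolding s using ceiling_correct[of "M * x"] by linarith+
  moreover have "\<lceil>M * x\<rceil> \<le> int M"
    using assms(1,2) M by (simp add: ceiling_le_iff mult_left_le)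
  then show "s \<le> M"
    unfolding s_def by linarith
  ultimately have "0 < real s" "M * x \<le> s" "s \<le> 2 * (M * x)"
    using Mx by linarith+
  then show "0 < s" "x \<le> s / M" "s / M \<le> 2 * x"
    using M by (simp_all add: pos_le_divide_eq pos_divide_le_eq ac_simps)
qed

text \<open>The prescribed densities are rounded up to fractions with a common denominator
  \<open>M\<close>, which serves both as the modulus n and as m in the layered hypergraph.\<close>

lemma star_density_realization:
  fixes \<alpha> \<xi> :: "nat \<Rightarrow> real"
  assumes c: "c < r"
    and \<alpha>: "\<And>k. k \<in> {1..l} \<Longrightarrow> 0 < \<alpha> k \<and> \<alpha> k \<le> 1"
    and \<xi>: "\<And>k. k \<in> {1..l} \<Longrightarrow> 0 < \<xi> k \<and> \<xi> k \<le> 1"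
  shows "\<exists>G :: nat hypergraph. uniform_hypergraph r G \<and> verts G \<noteq> {} \<and> (\<forall>b\<in>{1..l}.
    (\<forall>k\<in>{1..l}. \<alpha> k ^ c * \<xi> k ^ b \<le> real r ^ c * (real r ^ (r - c)) ^ b * hom_density (star r b c) G) \<and>
    hom_density (star r b c) G
      \<le> real l ^ b * (2 ^ (r - c)) ^ b * 2 ^ c * (2 ^ c * 2 ^ b * (\<Sum>k=1..l. \<alpha> k ^ c * \<xi> k ^ b)))"
proof -
  \<comment> \<open>The sum dominates every single reciprocal, as the rounding demands; the added 1
    keeps \<open>M\<close> positive even for an empty sum.\<close>
  obtain M :: nat where M: "1 + (\<Sum>k=1..l. 1 / \<alpha> k + 1 / \<xi> k) \<le> M"
    using real_arch_simple by blast
  have nn: "0 \<le> 1 / \<alpha> k + 1 / \<xi> k" if "k \<in> {1..l}" for k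
    using \<alpha>[OF that] \<xi>[OF that] by simp
  have "0 < real M"
    using M sum_nonneg[of "{1..l}" "\<lambda>k. 1 / \<alpha> k + 1 / \<xi> k", OF nn] by linarith
  then have M0: "0 < M"
    by simp
  have le: "1 / \<alpha> k \<le> M" "1 / \<xi> k \<le> M" if "k \<in> {1..l}" for k
  proof -
    have "1 / \<alpha> k + 1 / \<xi> k \<le> (\<Sum>k=1..l. 1 / \<alpha> k + 1 / \<xi> k)"
      using that nn by (intro member_le_sum) simp_all
    moreover have "0 \<le> 1 / \<alpha> k" "0 \<le> 1 / \<xi> k"
      using \<alpha>[OF that] \<xi>[OF that] by simp_all
    ultimately show "1 / \<alpha> k \<le> M" "1 / \<xi> k \<le> M"
      using M by linarith+
  qed
  define s where "s k = nat \<lceil>M * \<alpha> k\<rceil>" for k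
  define t where "t k = nat \<lceil>M * \<xi> k\<rceil>" for k
  have s: "0 < s k \<and> s k \<le> M" "\<alpha> k \<le> s k / M" "s k / M \<le> 2 * \<alpha> k" if "k \<in> {1..l}" for k
    unfolding s_def using nat_ceiling_approx[of "\<alpha> k" M] \<alpha>[OF that] le(1)[OF that] by simp_all
  have t: "t k \<le> M" "\<xi> k \<le> t k / M" "t k / M \<le> 2 * \<xi> k" if "k \<in> {1..l}" for k
    unfolding t_def using nat_ceiling_approx[of "\<xi> k" M] \<xi>[OF that] le(2)[OF that] by simp_all
  let ?G = "layered r c l M M s t"
  show ?thesis
  proof (intro exI[of _ ?G] conjI ballI)
    show "uniform_hypergraph r ?G"
      by (rule layered_uniform)
    show "verts ?G \<noteq> {}"
      using c M0 by (simp add: layered_def lessThan_empty_iff)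
  next
    fix b k assume b: "b \<in> {1..l}" and k: "k \<in> {1..l}"
    have "\<alpha> k ^ c * \<xi> k ^ b \<le> (s k / M) ^ c * (t k / M) ^ b"
      using s[OF k] t[OF k] \<alpha>[OF k] \<xi>[OF k] by (intro mult_mono power_mono) simp_all
    also have "\<dots> \<le> real r ^ c * (real r ^ (r - c)) ^ b * hom_density (star r b c) ?G"
      using s[OF k] t[OF k] by (intro layered_density_ge c M0 k) simp_all
    finally show "\<alpha> k ^ c * \<xi> k ^ b \<le> real r ^ c * (real r ^ (r - c)) ^ b * hom_density (star r b c) ?G" .
  next
    fix b assume b: "b \<in> {1..l}"
    have "hom_density (star r b c) ?G
        \<le> real l ^ b * (2 ^ (r - c)) ^ b * 2 ^ c * (\<Sum>k=1..l. (s k / M) ^ c * (t k / M) ^ b)"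
      using b s t by (intro layered_density_le c M0) simp_all
    also have "\<dots> \<le> real l ^ b * (2 ^ (r - c)) ^ b * 2 ^ c * (\<Sum>k=1..l. (2 * \<alpha> k) ^ c * (2 * \<xi> k) ^ b)"
    proof (intro mult_left_mono sum_mono)
      fix k assume k: "k \<in> {1..l}"
      show "(s k / M) ^ c * (t k / M) ^ b \<le> (2 * \<alpha> k) ^ c * (2 * \<xi> k) ^ b"
        using s[OF k] t[OF k] \<alpha>[OF k] \<xi>[OF k] by (intro mult_mono power_mono) simp_all
    qed simp
    also have "(\<Sum>k=1..l. (2 * \<alpha> k) ^ c * (2 * \<xi> k) ^ b) = 2 ^ c * 2 ^ b * (\<Sum>k=1..l. \<alpha> k ^ c * \<xi> k ^ b)"
      by (simp only: sum_distrib_left power_mult_distrib) (simp only: ac_simps)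
    finally show "hom_density (star r b c) ?G
      \<le> real l ^ b * (2 ^ (r - c)) ^ b * 2 ^ c * (2 ^ c * 2 ^ b * (\<Sum>k=1..l. \<alpha> k ^ c * \<xi> k ^ b))" .
  qed
qed

text \<open>At b the line \<open>L b\<close> attains the value of the sequence, which gives the
  lower bound; none of the l lines exceeds that value, which gives the upper bound at the cost of a
  factor l.\<close>

lemma star_density_convex_realization:
  assumes c: "1 \<le> c" "c < r" and pos: "\<And>b. b \<in> {1..l} \<Longrightarrow> 0 \<le> second_diff l \<sigma> b y"
    and q: "1 < (q::real)"
  shows "\<exists>G :: nat hypergraph. uniform_hypergraph r G \<and> verts G \<noteq> {} \<and> (\<forall>b\<in>{1..l}.
    q powr ext_coord l \<sigma> y b \<le> real r ^ c * (real r ^ (r - c)) ^ b * hom_density (star r b c) G \<and>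
    hom_density (star r b c) G
      \<le> real l ^ b * (2 ^ (r - c)) ^ b * 2 ^ c * (2 ^ c * 2 ^ b * real l) * q powr ext_coord l \<sigma> y b)"
proof -
  define z where "z = ext_coord l \<sigma> y"
  \<comment> \<open>The line \<open>L j\<close> passes through the points j - 1 and j of the
    sequence; indexing it by the right endpoint gives \<open>L b b = z b\<close> for every b from 1
    on.\<close>
  define d where "d j = z j - z (j - 1)" for j
  define L where "L j b = z (j - 1) + (real b - real (j - 1)) * d j" for j b
  have L_le: "L j b \<le> z b" if "j \<in> {1..l}" "b \<le> l" for j b
  proof -
    have "j - 1 < l" "j - 1 + 1 = j"
      using that by auto
    then show ?thesis
      using ext_coord_tangent[OF pos, of "j - 1" b] that by (simp only: L_def d_def z_def)
  qed
  have L_eq: "L b b = z b" if "1 \<le> b" for b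
    using that by (simp add: L_def d_def of_nat_diff)
  have d: "d j \<le> 0" if "j \<in> {1..l}" for j
  proof -
    have "0 < l" "j - 1 \<le> l" "j - 1 + 1 = j"
      using that by auto
    then show ?thesis
      using ext_coord_slope_nonpos[OF pos, of "j - 1"] by (simp add: d_def z_def)
  qed
  have L0: "L j 0 \<le> 0" if "j \<in> {1..l}" for j
    using L_le[OF that, of 0] by (simp add: z_def ext_coord_def)
  \<comment> \<open>The division by c compensates for the power c with which \<open>\<alpha>\<close>
    enters; the signs of \<open>L j 0\<close> and \<open>d j\<close> keep \<open>\<alpha>\<close>
    and \<open>\<xi>\<close> at most 1.\<close>
  define \<alpha> where "\<alpha> j = q powr (L j 0 / c)" for j
  define \<xi> where "\<xi> j = q powr d j" for j
  have prod: "\<alpha> j ^ c * \<xi> j ^ b = q powr L j b" for j b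
  proof -
    have "\<alpha> j ^ c * \<xi> j ^ b = q powr (L j 0 / c * c) * q powr (d j * b)"
      using q by (simp add: \<alpha>_def \<xi>_def powr_realpow[symmetric] powr_powr)
    also have "\<dots> = q powr (L j 0 + d j * b)"
      using c by (simp add: powr_add)
    also have "L j 0 + d j * b = L j b"
      by (simp add: L_def algebra_simps)
    finally show ?thesis .
  qed
  have "\<exists>G :: nat hypergraph. uniform_hypergraph r G \<and> verts G \<noteq> {} \<and> (\<forall>b\<in>{1..l}.
    (\<forall>k\<in>{1..l}. \<alpha> k ^ c * \<xi> k ^ b \<le> real r ^ c * (real r ^ (r - c)) ^ b * hom_density (star r b c) G) \<and>
    hom_density (star r b c) G
      \<le> real l ^ b * (2 ^ (r - c)) ^ b * 2 ^ c * (2 ^ c * 2 ^ b * (\<Sum>k=1..l. \<alpha> k ^ c * \<xi> k ^ b)))"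
  proof (rule star_density_realization[OF c(2)])
    fix k assume k: "k \<in> {1..l}"
    have "L k 0 / c \<le> 0"
      using L0[OF k] by (simp add: divide_nonpos_nonneg)
    then show "0 < \<alpha> k \<and> \<alpha> k \<le> 1"
      unfolding \<alpha>_def using q powr_mono[of "L k 0 / c" 0 q] by simp
    show "0 < \<xi> k \<and> \<xi> k \<le> 1"
      unfolding \<xi>_def using q d[OF k] powr_mono[of "d k" 0 q] by simp
  qed
  then obtain G :: "nat hypergraph" where G: "uniform_hypergraph r G" "verts G \<noteq> {}"
    and lower: "\<And>b k. b \<in> {1..l} \<Longrightarrow> k \<in> {1..l} \<Longrightarrow>
      q powr L k b \<le> real r ^ c * (real r ^ (r - c)) ^ b * hom_density (star r b c) G"
    and upper: "\<And>b. b \<in> {1..l} \<Longrightarrow> hom_density (star r b c) G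
      \<le> real l ^ b * (2 ^ (r - c)) ^ b * 2 ^ c * (2 ^ c * 2 ^ b * (\<Sum>k=1..l. q powr L k b))"
    unfolding prod by blast
  show ?thesis
  proof (intro exI[of _ G] conjI ballI G)
    fix b assume b: "b \<in> {1..l}"
    show "q powr ext_coord l \<sigma> y b \<le> real r ^ c * (real r ^ (r - c)) ^ b * hom_density (star r b c) G"
      using lower[OF b b] L_eq[of b] b by (simp add: z_def)
    have "(\<Sum>k=1..l. q powr L k b) \<le> real (card {1..l}) * q powr z b"
      using q b by (intro sum_bounded_above powr_mono L_le) simp_all
    then have "(\<Sum>k=1..l. q powr L k b) \<le> l * q powr z b"
      by simp
    then have "real l ^ b * (2 ^ (r - c)) ^ b * 2 ^ c * (2 ^ c * 2 ^ b * (\<Sum>k=1..l. q powr L k b))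
        \<le> real l ^ b * (2 ^ (r - c)) ^ b * 2 ^ c * (2 ^ c * 2 ^ b * (l * q powr z b))"
      by (intro mult_left_mono) simp_all
    with upper[OF b] show "hom_density (star r b c) G
      \<le> real l ^ b * (2 ^ (r - c)) ^ b * 2 ^ c * (2 ^ c * 2 ^ b * real l) * q powr ext_coord l \<sigma> y b"
      by (simp only: z_def mult.assoc)
  qed
qed

section \<open>Passage to the limit of logarithms\<close>

text \<open>Constant factors change ln f by a bounded amount, which vanishes after division by ln
  q.\<close>

lemma tendsto_ln_ratio:
  fixes f q :: "nat \<Rightarrow> real"
  assumes "filterlim q at_top sequentially" "\<And>k. 1 < q k" "0 < A" "0 < B"
    and "\<And>k. q k powr z \<le> A * f k" "\<And>k. f k \<le> B * q k powr z"
  shows "(\<lambda>k. ln (f k) / ln (q k)) \<longlonglongrightarrow> z"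
proof -
  have ln_q: "filterlim (\<lambda>k. ln (q k)) at_top sequentially"
    by (rule filterlim_compose[OF ln_at_top assms(1)])
  have pos: "0 < f k" for k
  proof -
    have "0 < q k powr z"
      using assms(2)[of k] by simp
    then have "0 < A * f k"
      using assms(5)[of k] by linarith
    then show ?thesis
      using assms(3) by (simp add: zero_less_mult_iff)
  qed
  have lnq: "0 < ln (q k)" for k
    using assms(2)[of k] by simp
  have lo: "z - ln A / ln (q k) \<le> ln (f k) / ln (q k)" for k
  proof -
    have "ln (q k powr z) \<le> ln (A * f k)"
      using assms(2)[of k] assms(5)[of k] by (intro ln_mono) auto
    then have "z * ln (q k) \<le> ln A + ln (f k)"
      using assms(2)[of k] assms(3) pos[of k] by (simp add: ln_powr ln_mult_pos)
    then show ?thesis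
      using lnq[of k] by (simp add: pos_le_divide_eq left_diff_distrib)
  qed
  have hi: "ln (f k) / ln (q k) \<le> z + ln B / ln (q k)" for k
  proof -
    have "ln (f k) \<le> ln (B * q k powr z)"
      using assms(6)[of k] pos[of k] by (intro ln_mono)
    then have "ln (f k) \<le> ln B + z * ln (q k)"
      using assms(2)[of k] assms(4) by (simp add: ln_powr ln_mult_pos)
    then show ?thesis
      using lnq[of k] by (simp add: pos_divide_le_eq distrib_right)
  qed
  have "(\<lambda>k. ln A / ln (q k)) \<longlonglongrightarrow> 0" "(\<lambda>k. ln B / ln (q k)) \<longlonglongrightarrow> 0"
    by (intro real_tendsto_divide_at_top[OF tendsto_const ln_q])+
  from tendsto_diff[OF tendsto_const this(1), of z] tendsto_add[OF tendsto_const this(2), of z]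
  have "(\<lambda>k. z - ln A / ln (q k)) \<longlonglongrightarrow> z" "(\<lambda>k. z + ln B / ln (q k)) \<longlonglongrightarrow> z"
    by simp_all
  then show ?thesis
    by (rule tendsto_sandwich[OF always_eventually[OF allI[OF lo]] always_eventually[OF allI[OF hi]]])
qed

text \<open>With \<tau> = 1 / q the tropical rescaling is division by ln q. The factors
  \<open>A b\<close> and \<open>B b\<close> do not depend on q, so only the exponents survive as q
  grows.\<close>

lemma second_diff_imp_trop_density_profile:
  fixes \<sigma> :: "nat \<Rightarrow> 'l::finite"
  assumes c: "1 \<le> c" "c < r" and bij: "bij_betw \<sigma> {1..l} (UNIV :: 'l set)"
    and pos: "\<And>b. b \<in> {1..l} \<Longrightarrow> 0 \<le> second_diff l \<sigma> b y"
  shows "y \<in> trop (density_profile r l \<sigma> (\<lambda>b. star r b c))"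
proof -
  \<comment> \<open>The offset 2 gives q > 1 already at k = 0, so that 1 / q lies in (0, 1).\<close>
  define q where "q k = real k + 2" for k
  define A where "A b = real r ^ c * (real r ^ (r - c)) ^ b" for b
  define B where "B b = real l ^ b * (2 ^ (r - c)) ^ b * 2 ^ c * (2 ^ c * 2 ^ b * real l)" for b
  have l: "0 < l"
    using bij by (cases l) (auto simp: bij_betw_def)
  have A: "0 < A b" and B: "0 < B b" for b
    using c l by (simp_all add: A_def B_def)
  have q: "1 < q k" for k
    by (simp add: q_def)
  have q_lim: "filterlim q at_top sequentially"
    unfolding q_def by (rule filterlim_at_top_mono[OF filterlim_real_sequentially]) simp
  have "\<exists>G. \<forall>k. uniform_hypergraph r (G k :: nat hypergraph) \<and> verts (G k) \<noteq> {} \<and> (\<forall>b\<in>{1..l}.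
     q k powr ext_coord l \<sigma> y b \<le> A b * hom_density (star r b c) (G k) \<and>
     hom_density (star r b c) (G k) \<le> B b * q k powr ext_coord l \<sigma> y b)"
    unfolding A_def B_def
    by (rule choice) (intro allI star_density_convex_realization c pos q)
  then obtain G :: "nat \<Rightarrow> nat hypergraph" where G: "\<And>k. uniform_hypergraph r (G k)" "\<And>k. verts (G k) \<noteq> {}"
    and lower: "\<And>k b. b \<in> {1..l} \<Longrightarrow> q k powr ext_coord l \<sigma> y b \<le> A b * hom_density (star r b c) (G k)"
    and upper: "\<And>k b. b \<in> {1..l} \<Longrightarrow> hom_density (star r b c) (G k) \<le> B b * q k powr ext_coord l \<sigma> y b"
    by blast
  define x :: "nat \<Rightarrow> real ^ 'l" where "x k = (\<chi> i. hom_density (star r (inv_into {1..l} \<sigma> i) c) (G k))" for k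
  have x: "x k $ \<sigma> b = hom_density (star r b c) (G k)" if "b \<in> {1..l}" for k b
    using bij_betw_inv_into_left[OF bij that] by (simp add: x_def)
  have ex: "\<exists>b\<in>{1..l}. i = \<sigma> b" for i
    using bij by (metis UNIV_I bij_betw_imp_surj_on imageE)
  have "x k \<in> density_profile r l \<sigma> (\<lambda>b. star r b c)" for k
    unfolding density_profile_def
    by (rule subsetD[OF closure_subset], rule CollectI, rule exI[of _ "G k"]) (simp add: G x)
  moreover have "0 < x k $ i" for k i
  proof -
    obtain b where b: "b \<in> {1..l}" "i = \<sigma> b"
      using ex by blast
    have "0 < q k powr ext_coord l \<sigma> y b"
      using q[of k] by simp
    then have "0 < A b * hom_density (star r b c) (G k)"
      using lower[OF b(1), of k] by linarith
    then show ?thesis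
      using A[of b] x[OF b(1)] b(2) by (simp add: zero_less_mult_iff)
  qed
  moreover have "(\<lambda>k. (- 1 / ln (1 / q k)) *\<^sub>R (\<chi> i. ln (x k $ i))) \<longlonglongrightarrow> y"
  proof (rule vec_tendstoI)
    fix i
    obtain b where b: "b \<in> {1..l}" "i = \<sigma> b"
      using ex by blast
    have "(\<lambda>k. ln (hom_density (star r b c) (G k)) / ln (q k)) \<longlonglongrightarrow> ext_coord l \<sigma> y b"
      by (rule tendsto_ln_ratio[OF q_lim q A B lower[OF b(1)] upper[OF b(1)]])
    moreover have "ext_coord l \<sigma> y b = y $ i"
      using b by (simp add: ext_coord_def)
    moreover have "((- 1 / ln (1 / q k)) *\<^sub>R (\<chi> i. ln (x k $ i))) $ i =
        ln (hom_density (star r b c) (G k)) / ln (q k)" for k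
      using q[of k] x[OF b(1)] b(2) by (simp add: ln_div)
    ultimately show "(\<lambda>k. ((- 1 / ln (1 / q k)) *\<^sub>R (\<chi> i. ln (x k $ i))) $ i) \<longlonglongrightarrow> y $ i"
      by (simp only:)
  qed
  moreover have "(\<lambda>k. 1 / q k) \<longlonglongrightarrow> 0"
    by (rule real_tendsto_divide_at_top[OF tendsto_const q_lim])
  moreover have "0 < 1 / q k \<and> 1 / q k < 1" for k
    using q[of k] by simp
  ultimately show ?thesis
    unfolding trop_def mem_Collect_eq
    by (intro exI[of _ "\<lambda>k. 1 / q k"] exI[of _ x]) simp
qed

theorem theorem3p6:
  fixes r c l :: nat and \<sigma> :: "nat \<Rightarrow> 'l::finite"
  assumes "r \<ge> 2" and "1 \<le> c" and "c \<le> r - 1" and "l \<ge> 2"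
    and "bij_betw \<sigma> {1..l} (UNIV :: 'l set)"
  shows "trop (density_profile r l \<sigma> (\<lambda>b. star r b c)) =
      {y :: real ^ 'l.
         - 2 * y $ \<sigma> 1 + y $ \<sigma> 2 \<ge> 0 \<and>
         (\<forall>b\<in>{2..l - 1}. y $ \<sigma> (b - 1) - 2 * y $ \<sigma> b + y $ \<sigma> (b + 1) \<ge> 0) \<and>
         y $ \<sigma> (l - 1) - y $ \<sigma> l \<ge> 0}
    \<and> {R. R extreme_ray_of trop (density_profile r l \<sigma> (\<lambda>b. star r b c))} =
      (\<lambda>b. cone hull {star_ray l \<sigma> b}) ` {1..l}"
proof -
  have c: "c < r"
    using assms by simp
  have trop: "trop (density_profile r l \<sigma> (\<lambda>b. star r b c)) = {y. \<forall>b\<in>{1..l}. 0 \<le> second_diff l \<sigma> b y}"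
    using trop_density_profile_second_diff second_diff_imp_trop_density_profile[OF assms(2) c assms(5)]
    by blast
  show ?thesis
  proof
    show "trop (density_profile r l \<sigma> (\<lambda>b. star r b c)) = {y. - 2 * y $ \<sigma> 1 + y $ \<sigma> 2 \<ge> 0 \<and>
         (\<forall>b\<in>{2..l - 1}. y $ \<sigma> (b - 1) - 2 * y $ \<sigma> b + y $ \<sigma> (b + 1) \<ge> 0) \<and>
         y $ \<sigma> (l - 1) - y $ \<sigma> l \<ge> 0}"
      unfolding trop by (rule Collect_cong) (rule second_diff_cone_iff[OF assms(4)])
    show "{R. R extreme_ray_of trop (density_profile r l \<sigma> (\<lambda>b. star r b c))} =
        (\<lambda>b. cone hull {star_ray l \<sigma> b}) ` {1..l}"
      unfolding trop
      by (rule extreme_rays_simplicial_cone[OF linear_second_diff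
            second_diff_star_ray[OF assms(5)] second_diff_eq_0_imp[OF assms(5)]])
  qed
qed

end
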